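(* Let $G\leq\mathrm{Sym}(\Omega)$ be a finite primitive permutation group without the weak-EKR property. Then $G$ can be embedded (as a permutation group) in a wreath product $L\wr S_k$ with its product action, where $k\geq1$, $L\leq\mathrm{Sym}(\Sigma)$ is almost simple, and $\Omega=\Sigma^k$.
   Context: Let $G\leq\mathrm{Sym}(\Omega)$ be a finite transitive permutation group with point stabiliser $H$. A subgroup $K\leq G$ is a fixer if every element of $K$ has a fixed point on $\Omega$. $G$ has the weak-EKR property if every fixer of $G$ has order at most $|H|$. $G$ is primitive if $H$ is a maximal subgroup of $G$. $L$ is almost simple if $T\trianglelefteq L\leq\mathrm{Aut}(T)$ for a non-abelian simple group $T$. In the product action, $L\wr S_k=L^k{:}S_k$ acts on $\Sigma^k$ with $L^k$ acting componentwise and $S_k$ permuting the coordinates. *)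

theory Defs
  imports "HOL-Algebra.Algebra"
begin

section \<open>Permutation groups\<close>

text \<open>
  A permutation group \<open>G \<le> Sym(\<Omega>)\<close> is a subgroup \<open>G\<close> of \<^term>\<open>BijGroup \<Omega>\<close>; it acts on
  \<open>\<Omega>\<close> via \<^term>\<open>id\<close>.
\<close>

definition perm_group :: "'a set \<Rightarrow> ('a \<Rightarrow> 'a) set \<Rightarrow> ('a \<Rightarrow> 'a) monoid" where
  "perm_group \<Omega> G = (BijGroup \<Omega>)\<lparr>carrier := G\<rparr>"

definition maximal_subgroup :: "'a set \<Rightarrow> ('a, 'b) monoid_scheme \<Rightarrow> bool" where
  "maximal_subgroup H G \<longleftrightarrow>
     subgroup H G \<and> H \<noteq> carrier G \<and>
     (\<forall>K. subgroup K G \<longrightarrow> H \<subseteq> K \<longrightarrow> K = H \<or> K = carrier G)"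

text \<open>
  The library's \<^locale>\<open>transitive_action\<close> admits the empty set, which is excluded here.  The point
  stabilisers of a transitive action are conjugate, so it is immaterial here and in
  \<open>weak_EKR\<close> below that all of them are considered instead of a fixed one.
\<close>

definition primitive_action ::
    "('g, 'm) monoid_scheme \<Rightarrow> 'a set \<Rightarrow> ('g \<Rightarrow> 'a \<Rightarrow> 'a) \<Rightarrow> bool" where
  "primitive_action G \<Omega> \<phi> \<longleftrightarrow>
     transitive_action G \<Omega> \<phi> \<and> \<Omega> \<noteq> {} \<and>
     (\<forall>\<omega>\<in>\<Omega>. maximal_subgroup (stabilizer G \<phi> \<omega>) G)"

definition fixer ::
    "('g, 'm) monoid_scheme \<Rightarrow> 'a set \<Rightarrow> ('g \<Rightarrow> 'a \<Rightarrow> 'a) \<Rightarrow> 'g set \<Rightarrow> bool" where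
  "fixer G \<Omega> \<phi> K \<longleftrightarrow> subgroup K G \<and> (\<forall>g\<in>K. \<exists>\<omega>\<in>\<Omega>. \<phi> g \<omega> = \<omega>)"

definition weak_EKR ::
    "('g, 'm) monoid_scheme \<Rightarrow> 'a set \<Rightarrow> ('g \<Rightarrow> 'a \<Rightarrow> 'a) \<Rightarrow> bool" where
  "weak_EKR G \<Omega> \<phi> \<longleftrightarrow>
     (\<forall>K. fixer G \<Omega> \<phi> K \<longrightarrow> (\<forall>\<omega>\<in>\<Omega>. card K \<le> card (stabilizer G \<phi> \<omega>)))"


section \<open>Almost simple groups\<close>

definition Inn :: "('a, 'b) monoid_scheme \<Rightarrow> ('a \<Rightarrow> 'a) set" where
  "Inn T = (\<lambda>g. \<lambda>x\<in>carrier T. g \<otimes>\<^bsub>T\<^esub> x \<otimes>\<^bsub>T\<^esub> inv\<^bsub>T\<^esub> g) ` carrier T"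

text \<open>
  \<open>T \<unlhd> L \<le> Aut(T)\<close>, up to isomorphism of \<open>L\<close>, with \<open>T\<close> identified with \<open>Inn(T)\<close> as usual.
  Taking \<open>T\<close> over the element type of \<open>L\<close> is no restriction, since \<open>T\<close> is isomorphic to a
  subgroup of \<open>L\<close>.  The library's \<^locale>\<open>simple_group\<close> includes finiteness, so this is the
  notion of a finite almost simple group.
\<close>

definition almost_simple :: "('a, 'b) monoid_scheme \<Rightarrow> bool" where
  "almost_simple L \<longleftrightarrow> group L \<and>
     (\<exists>(T :: 'a monoid) A. simple_group T \<and> \<not> comm_group T \<and>
        subgroup A (AutoGroup T) \<and>
        Inn T \<lhd> (AutoGroup T)\<lparr>carrier := A\<rparr> \<and>
        L \<cong> (AutoGroup T)\<lparr>carrier := A\<rparr>)"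


section \<open>Wreath products with their product action\<close>

text \<open>
  The semidirect product \<open>L\<^sup>k : S\<^sub>k\<close>: the pair \<open>(a, \<sigma>)\<close> stands for \<open>a\<sigma>\<close>, and \<open>\<sigma>\<close> moves the
  \<open>i\<close>-th coordinate to position \<open>\<sigma> i\<close>.
\<close>

definition wreath_product ::
    "('a, 'b) monoid_scheme \<Rightarrow> nat \<Rightarrow> ((nat \<Rightarrow> 'a) \<times> (nat \<Rightarrow> nat)) monoid" where
  "wreath_product L k =
     \<lparr>carrier = carrier (product_group {1..k} (\<lambda>_. L)) \<times> carrier (sym_group k),
      monoid.mult = (\<lambda>(a, \<sigma>) (b, \<tau>).
        (a \<otimes>\<^bsub>product_group {1..k} (\<lambda>_. L)\<^esub> (\<lambda>i\<in>{1..k}. b (inv_into UNIV \<sigma> i)), \<sigma> \<circ> \<tau>)),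
      one = (\<one>\<^bsub>product_group {1..k} (\<lambda>_. L)\<^esub>, id)\<rparr>"

abbreviation cartesian_power :: "'a set \<Rightarrow> nat \<Rightarrow> (nat \<Rightarrow> 'a) set" where
  "cartesian_power S k \<equiv> {1..k} \<rightarrow>\<^sub>E S"

definition product_action ::
    "'a set \<Rightarrow> nat \<Rightarrow> (nat \<Rightarrow> 'a \<Rightarrow> 'a) \<times> (nat \<Rightarrow> nat) \<Rightarrow> (nat \<Rightarrow> 'a) \<Rightarrow> (nat \<Rightarrow> 'a)" where
  "product_action S k = (\<lambda>(a, \<sigma>). \<lambda>x\<in>cartesian_power S k. \<lambda>i\<in>{1..k}. a i (x (inv_into UNIV \<sigma> i)))"

text \<open>
  \<open>G\<close> acting on \<open>\<Omega>\<close> embeds, as a permutation group, in \<open>W\<close> acting on \<open>\<Delta>\<close>: a group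
  monomorphism compatible with an identification of \<open>\<Omega>\<close> with \<open>\<Delta>\<close>.
\<close>

definition perm_embeds ::
    "('g, 'm) monoid_scheme \<Rightarrow> 'a set \<Rightarrow> ('g \<Rightarrow> 'a \<Rightarrow> 'a) \<Rightarrow>
     ('h, 'n) monoid_scheme \<Rightarrow> 'b set \<Rightarrow> ('h \<Rightarrow> 'b \<Rightarrow> 'b) \<Rightarrow> bool" where
  "perm_embeds G \<Omega> \<phi> W \<Delta> \<psi> \<longleftrightarrow>
     (\<exists>h f. h \<in> hom G W \<and> inj_on h (carrier G) \<and> bij_betw f \<Omega> \<Delta> \<and>
        (\<forall>g\<in>carrier G. \<forall>\<omega>\<in>\<Omega>. f (\<phi> g \<omega>) = \<psi> (h g) (f \<omega>)))"


section \<open>Well-definedness\<close>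

lemma perm_group_action:
  assumes "subgroup G (BijGroup \<Omega>)"
  shows "faithful_action (perm_group \<Omega> G) \<Omega> id"
proof -
  have "group (perm_group \<Omega> G)"
    unfolding perm_group_def by (rule subgroup.subgroup_is_group[OF assms group_BijGroup])
  moreover have "id \<in> hom (perm_group \<Omega> G) (BijGroup \<Omega>)"
    using subgroup.subset[OF assms] by (auto simp: hom_def perm_group_def)
  ultimately have "group_action (perm_group \<Omega> G) \<Omega> id"
    by (simp add: group_action_def group_hom_def group_hom_axioms_def group_BijGroup)
  then show ?thesis
    by (simp add: faithful_action_def faithful_action_axioms_def)
qed

lemma permutes_inv_into_mem:
  assumes "\<sigma> permutes {1..k::nat}" "i \<in> {1..k}"
  shows "inv_into UNIV \<sigma> i \<in> {1..k}"
  using permutes_in_image[OF permutes_inv[OF assms(1)]] assms(2) by simp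

lemma permutes_inv_into_comp:
  assumes "\<sigma> permutes S" "\<tau> permutes S"
  shows "inv_into UNIV (\<sigma> \<circ> \<tau>) i = inv_into UNIV \<tau> (inv_into UNIV \<sigma> i)"
  using o_inv_distrib[OF permutes_bij[OF assms(1)] permutes_bij[OF assms(2)]] by simp

theorem group_wreath_product:
  assumes "group L"
  shows "group (wreath_product L k)"
proof -
  interpret L: group L by fact
  show ?thesis
  proof (rule groupI)
    fix x y assume "x \<in> carrier (wreath_product L k)" "y \<in> carrier (wreath_product L k)"
    then show "x \<otimes>\<^bsub>wreath_product L k\<^esub> y \<in> carrier (wreath_product L k)"
      using permutes_inv_into_mem
      by (fastforce simp: wreath_product_def product_group_def sym_group_def PiE_iff
          intro!: permutes_compose)
  next
    show "\<one>\<^bsub>wreath_product L k\<^esub> \<in> carrier (wreath_product L k)"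
      by (auto simp: wreath_product_def product_group_def sym_group_def permutes_id)
  next
    fix x y z
    assume xyz: "x \<in> carrier (wreath_product L k)" "y \<in> carrier (wreath_product L k)"
      "z \<in> carrier (wreath_product L k)"
    obtain a \<sigma> b \<tau> c \<rho> where [simp]: "x = (a, \<sigma>)" "y = (b, \<tau>)" "z = (c, \<rho>)"
      by (metis surj_pair)
    have \<sigma>: "\<sigma> permutes {1..k}" and \<tau>: "\<tau> permutes {1..k}"
      and mem: "\<And>i. i \<in> {1..k} \<Longrightarrow> a i \<in> carrier L" "\<And>i. i \<in> {1..k} \<Longrightarrow> b i \<in> carrier L"
        "\<And>i. i \<in> {1..k} \<Longrightarrow> c i \<in> carrier L"
      using xyz by (auto simp: wreath_product_def product_group_def sym_group_def PiE_iff)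
    have "a i \<otimes>\<^bsub>L\<^esub> b (inv_into UNIV \<sigma> i) \<otimes>\<^bsub>L\<^esub> c (inv_into UNIV (\<sigma> \<circ> \<tau>) i) =
        a i \<otimes>\<^bsub>L\<^esub> (b (inv_into UNIV \<sigma> i) \<otimes>\<^bsub>L\<^esub> c (inv_into UNIV \<tau> (inv_into UNIV \<sigma> i)))"
      if i: "i \<in> {1..k}" for i
    proof -
      note i' = permutes_inv_into_mem[OF \<sigma> i]
      show ?thesis
        unfolding permutes_inv_into_comp[OF \<sigma> \<tau>]
        by (rule L.m_assoc[OF mem(1)[OF i] mem(2)[OF i'] mem(3)[OF permutes_inv_into_mem[OF \<tau> i']]])
    qed
    then show "x \<otimes>\<^bsub>wreath_product L k\<^esub> y \<otimes>\<^bsub>wreath_product L k\<^esub> z =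
        x \<otimes>\<^bsub>wreath_product L k\<^esub> (y \<otimes>\<^bsub>wreath_product L k\<^esub> z)"
      using permutes_inv_into_mem[OF \<sigma>]
      by (simp add: wreath_product_def product_group_def o_assoc cong: restrict_cong
          del: atLeastAtMost_iff)
  next
    fix x assume "x \<in> carrier (wreath_product L k)"
    moreover obtain a \<sigma> where "x = (a, \<sigma>)" by (metis surj_pair)
    ultimately show "\<one>\<^bsub>wreath_product L k\<^esub> \<otimes>\<^bsub>wreath_product L k\<^esub> x = x"
      by (auto simp: wreath_product_def product_group_def sym_group_def PiE_iff
          fun_eq_iff restrict_def extensional_def)
  next
    fix x assume x: "x \<in> carrier (wreath_product L k)"
    obtain a \<sigma> where [simp]: "x = (a, \<sigma>)" by (metis surj_pair)
    have \<sigma>: "\<sigma> permutes {1..k}" and a: "\<And>i. i \<in> {1..k} \<Longrightarrow> a i \<in> carrier L"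
      using x by (auto simp: wreath_product_def product_group_def sym_group_def PiE_iff)
    have \<sigma>_mem: "\<sigma> i \<in> {1..k}" if "i \<in> {1..k}" for i
      using permutes_in_image[OF \<sigma>] that by simp
    let ?y = "(\<lambda>i\<in>{1..k}. inv\<^bsub>L\<^esub> a (\<sigma> i), inv_into UNIV \<sigma>)"
    have "?y \<in> carrier (wreath_product L k)"
      using a \<sigma>_mem permutes_inv[OF \<sigma>]
      by (auto simp: wreath_product_def product_group_def sym_group_def PiE_iff)
    moreover have "?y \<otimes>\<^bsub>wreath_product L k\<^esub> x = \<one>\<^bsub>wreath_product L k\<^esub>"
      using a \<sigma>_mem
      by (auto simp: wreath_product_def product_group_def fun_eq_iff restrict_def
          permutes_inv_inv[OF \<sigma>] permutes_inverses[OF \<sigma>])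
    ultimately show "\<exists>y\<in>carrier (wreath_product L k).
        y \<otimes>\<^bsub>wreath_product L k\<^esub> x = \<one>\<^bsub>wreath_product L k\<^esub>" by blast
  qed
qed

theorem product_action_action:
  assumes "subgroup L (BijGroup S)"
  shows "group_action (wreath_product (perm_group S L) k) (cartesian_power S k) (product_action S k)"
proof -
  let ?W = "wreath_product (perm_group S L) k" and ?X = "cartesian_power S k"
  have W: "group ?W"
    using perm_group_action[OF assms] group_wreath_product
    by (auto simp: faithful_action_def group_action_def group_hom_def)
  have L: "bij_betw l S S" "l \<in> extensional S" if "l \<in> L" for l
    using subgroup.subset[OF assms] that by (auto simp: BijGroup_def Bij_def)
  have bij: "product_action S k w \<in> Bij ?X" if "w \<in> carrier ?W" for w
  proof -
    obtain a \<sigma> where w: "w = (a, \<sigma>)" by (metis surj_pair)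
    have \<sigma>: "\<sigma> permutes {1..k}" and a: "\<And>i. i \<in> {1..k} \<Longrightarrow> a i \<in> L"
      using that by (auto simp: w wreath_product_def product_group_def sym_group_def PiE_iff
          perm_group_def)
    have \<sigma>_mem: "\<sigma> i \<in> {1..k}" if "i \<in> {1..k}" for i
      using permutes_in_image[OF \<sigma>] that by simp
    note \<sigma>i_mem = permutes_inv_into_mem[OF \<sigma>]
    let ?g = "\<lambda>y. \<lambda>i\<in>{1..k}. inv_into S (a (\<sigma> i)) (y (\<sigma> i))"
    have "bij_betw (product_action S k w) ?X ?X"
    proof (rule bij_betw_byWitness[where f' = ?g])
      have aS: "a i s \<in> S" if "i \<in> {1..k}" "s \<in> S" for i s
        using L(1)[OF a[OF that(1)]] that(2) by (rule bij_betwE[rule_format])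
      have iS: "inv_into S (a i) s \<in> S" if "i \<in> {1..k}" "s \<in> S" for i s
        using bij_betw_inv_into[OF L(1)[OF a[OF that(1)]]] that(2) by (rule bij_betwE[rule_format])
      have memS: "x i \<in> S" if "x \<in> ?X" "i \<in> {1..k}" for x i
        using that by (rule PiE_mem)
      have fX: "product_action S k w x \<in> ?X" if x: "x \<in> ?X" for x
      proof -
        have "(\<lambda>i\<in>{1..k}. a i (x (inv_into UNIV \<sigma> i))) \<in> ?X"
          by (intro restrict_PiE_iff[THEN iffD2] ballI aS memS[OF x] \<sigma>i_mem)
        then show ?thesis using x by (simp add: w product_action_def)
      qed
      have gX: "?g y \<in> ?X" if y: "y \<in> ?X" for y
        by (intro restrict_PiE_iff[THEN iffD2] ballI iS memS[OF y] \<sigma>_mem)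
      show "product_action S k w ` ?X \<subseteq> ?X" "?g ` ?X \<subseteq> ?X"
        using fX gX by (blast intro: image_subsetI)+
      show "\<forall>x\<in>?X. ?g (product_action S k w x) = x"
      proof
        fix x assume x: "x \<in> ?X"
        show "?g (product_action S k w x) = x"
        proof (rule extensionalityI[where A = "{1..k}"])
          fix i assume i: "i \<in> {1..k}"
          have "inv_into S (a (\<sigma> i)) (a (\<sigma> i) (x i)) = x i"
            by (rule bij_betw_inv_into_left[OF L(1)[OF a[OF \<sigma>_mem[OF i]]] memS[OF x i]])
          then show "?g (product_action S k w x) i = x i"
            using x i \<sigma>_mem[OF i] by (simp add: w product_action_def permutes_inverses[OF \<sigma>])
        qed (use x in \<open>auto simp: PiE_iff\<close>)
      qed
      show "\<forall>y\<in>?X. product_action S k w (?g y) = y"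
      proof
        fix y assume y: "y \<in> ?X"
        note gy = gX[OF y]
        show "product_action S k w (?g y) = y"
        proof (rule extensionalityI[where A = "{1..k}"])
          fix i assume i: "i \<in> {1..k}"
          have "a i (inv_into S (a i) (y i)) = y i"
            by (rule bij_betw_inv_into_right[OF L(1)[OF a[OF i]] memS[OF y i]])
          then show "product_action S k w (?g y) i = y i"
            using gy i \<sigma>i_mem[OF i] by (simp add: w product_action_def permutes_inverses[OF \<sigma>])
        qed (use gy y in \<open>auto simp: w product_action_def PiE_iff\<close>)
      qed
    qed
    then show ?thesis
      by (auto simp: Bij_def product_action_def w)
  qed
  have "product_action S k (v \<otimes>\<^bsub>?W\<^esub> w) =
      product_action S k v \<otimes>\<^bsub>BijGroup ?X\<^esub> product_action S k w"
    if v: "v \<in> carrier ?W" and w: "w \<in> carrier ?W" for v w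
  proof -
    obtain a \<sigma> b \<tau> where vw: "v = (a, \<sigma>)" "w = (b, \<tau>)" by (metis surj_pair)
    have \<sigma>: "\<sigma> permutes {1..k}" and a: "\<And>i. i \<in> {1..k} \<Longrightarrow> a i \<in> L"
      and \<tau>: "\<tau> permutes {1..k}" and b: "\<And>i. i \<in> {1..k} \<Longrightarrow> b i \<in> L"
      using v w by (auto simp: vw wreath_product_def product_group_def sym_group_def PiE_iff
          perm_group_def)
    have mult: "(l \<otimes>\<^bsub>BijGroup S\<^esub> m) s = l (m s)" if "l \<in> L" "m \<in> L" "s \<in> S" for l m s
      using subgroup.subset[OF assms] that by (auto simp: BijGroup_def compose_def)
    show ?thesis
    proof (rule extensionalityI[where A = ?X])
      fix x assume x: "x \<in> ?X"
      have wx: "product_action S k w x \<in> ?X"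
        using bij[OF w] x by (auto simp: Bij_def dest: bij_betwE)
      show "product_action S k (v \<otimes>\<^bsub>?W\<^esub> w) x =
          (product_action S k v \<otimes>\<^bsub>BijGroup ?X\<^esub> product_action S k w) x"
      proof (rule extensionalityI[where A = "{1..k}"])
        fix i assume i: "i \<in> {1..k}"
        note i' = permutes_inv_into_mem[OF \<sigma> i]
        note i'' = permutes_inv_into_mem[OF \<tau> i']
        have "x (inv_into UNIV \<tau> (inv_into UNIV \<sigma> i)) \<in> S"
          using x i'' by (rule PiE_mem)
        note m = mult[OF a[OF i] b[OF i'] this]
        have "(product_action S k v \<otimes>\<^bsub>BijGroup ?X\<^esub> product_action S k w) x i =
            product_action S k v (product_action S k w x) i"
          using x bij[OF v] bij[OF w] by (simp add: BijGroup_def compose_def)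
        also have "\<dots> = a i (product_action S k w x (inv_into UNIV \<sigma> i))"
          using wx i by (simp add: vw(1) product_action_def)
        also have "\<dots> = a i (b (inv_into UNIV \<sigma> i) (x (inv_into UNIV \<tau> (inv_into UNIV \<sigma> i))))"
          using x i' by (simp add: vw(2) product_action_def)
        also have "\<dots> = product_action S k (v \<otimes>\<^bsub>?W\<^esub> w) x i"
          using x i m
          by (simp add: vw product_action_def wreath_product_def product_group_def perm_group_def
              permutes_inv_into_comp[OF \<sigma> \<tau>])
        finally show "product_action S k (v \<otimes>\<^bsub>?W\<^esub> w) x i =
            (product_action S k v \<otimes>\<^bsub>BijGroup ?X\<^esub> product_action S k w) x i" ..
      next
        show "product_action S k (v \<otimes>\<^bsub>?W\<^esub> w) x \<in> extensional {1..k}"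
          using x by (simp add: vw wreath_product_def product_action_def)
        show "(product_action S k v \<otimes>\<^bsub>BijGroup ?X\<^esub> product_action S k w) x \<in> extensional {1..k}"
          using x wx bij[OF v] bij[OF w]
          by (simp add: BijGroup_def compose_def) (simp add: vw(1) product_action_def)
      qed
    next
      show "product_action S k (v \<otimes>\<^bsub>?W\<^esub> w) \<in> extensional ?X"
        by (simp add: vw wreath_product_def product_action_def)
      show "product_action S k v \<otimes>\<^bsub>BijGroup ?X\<^esub> product_action S k w \<in> extensional ?X"
        using bij[OF v] bij[OF w] by (simp add: BijGroup_def)
    qed
  qed
  then have "product_action S k \<in> hom ?W (BijGroup ?X)"
    using bij by (auto simp: hom_def BijGroup_def)
  then show ?thesis
    using W by (simp add: group_action_def group_hom_def group_hom_axioms_def group_BijGroup)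
qed

end

theory Submission
  imports Defs
begin

text \<open>
  The O'Nan--Scott theorem is not needed. A fixer meets a regular subgroup trivially, so \<open>G\<close> has no
  regular subgroup. A nontrivial normal subgroup is transitive, and its centraliser, which is normal and
  semiregular, is therefore trivial. Let \<open>N\<close> be a minimal normal subgroup, \<open>T\<close> a minimal normal
  subgroup of \<open>N\<close>, and \<open>T\<^sub>1, \<dots>, T\<^sub>k\<close> the conjugates of \<open>T\<close> in \<open>G\<close>: then \<open>N\<close> is the direct product
  of the \<open>T\<^sub>i\<close>, and \<open>T\<close> is simple and non-abelian. Let \<open>C\<^sub>i\<close> be the product of the \<open>T\<^sub>j\<close> with
  \<open>j \<noteq> i\<close>, and \<open>Q\<^sub>i = N\<^sub>w C\<^sub>i\<close>. Maximality of the stabiliser of \<open>w\<close> makes \<open>N\<^sub>w\<close> and \<open>N\<close> the only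
  subgroups between \<open>N\<^sub>w\<close> and \<open>N\<close> that it normalises, so the intersection of the \<open>Q\<^sub>i\<close> is \<open>N\<^sub>w\<close>
  or \<open>N\<close>. In the second case a product of \<open>T\<^sub>i\<close>, maximal subject to meeting \<open>N\<^sub>w\<close> trivially, is
  regular. In the first case a point is determined by its \<open>k\<close> orbits under \<open>C\<^sub>1, \<dots>, C\<^sub>k\<close>, which can
  be chosen independently; conjugating each to an orbit of the product of the conjugates other than \<open>T\<close>
  gives the coordinates, and \<open>L\<close> is the action of the normaliser of \<open>T\<close> on these orbits.
\<close>

section \<open>Conjugation and minimal invariant subgroups\<close>

context group
begin

definition conjug :: "'a \<Rightarrow> 'a \<Rightarrow> 'a" where
  "conjug g x = g \<otimes> x \<otimes> inv g"

lemma inv_cancel_left [simp]: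
  assumes "x \<in> carrier G" "y \<in> carrier G"
  shows "x \<otimes> (inv x \<otimes> y) = y" "inv x \<otimes> (x \<otimes> y) = y"
  using assms by (simp_all flip: m_assoc)

lemma conjug_closed [simp, intro]:
  "g \<in> carrier G \<Longrightarrow> x \<in> carrier G \<Longrightarrow> conjug g x \<in> carrier G"
  by (simp add: conjug_def)

lemma conjug_mult_left:
  "g \<in> carrier G \<Longrightarrow> h \<in> carrier G \<Longrightarrow> x \<in> carrier G \<Longrightarrow>
     conjug (g \<otimes> h) x = conjug g (conjug h x)"
  by (simp add: conjug_def m_assoc inv_mult_group)

lemma conjug_mult:
  "g \<in> carrier G \<Longrightarrow> x \<in> carrier G \<Longrightarrow> y \<in> carrier G \<Longrightarrow>
     conjug g (x \<otimes> y) = conjug g x \<otimes> conjug g y"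
  by (simp add: conjug_def m_assoc)

lemma conjug_one [simp]: "g \<in> carrier G \<Longrightarrow> conjug g \<one> = \<one>"
  by (simp add: conjug_def)

lemma conjug_by_one [simp]: "x \<in> carrier G \<Longrightarrow> conjug \<one> x = x"
  by (simp add: conjug_def)

lemma conjug_inv_cancel [simp]:
  assumes "g \<in> carrier G" "x \<in> carrier G"
  shows "conjug (inv g) (conjug g x) = x" "conjug g (conjug (inv g) x) = x"
  using assms by (simp_all flip: conjug_mult_left)

lemma conjug_mult_right:
  "g \<in> carrier G \<Longrightarrow> x \<in> carrier G \<Longrightarrow> g \<otimes> x = conjug g x \<otimes> g"
  by (simp add: conjug_def m_assoc)

lemma conjug_fixed_iff:
  assumes "g \<in> carrier G" "x \<in> carrier G"
  shows "conjug g x = x \<longleftrightarrow> g \<otimes> x = x \<otimes> g"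
  using assms by (metis conjug_closed conjug_mult_right m_closed right_cancel)

lemma conjug_eq_one_iff [simp]:
  assumes "g \<in> carrier G" "x \<in> carrier G"
  shows "conjug g x = \<one> \<longleftrightarrow> x = \<one>"
  using assms by (metis conjug_inv_cancel(1) conjug_one inv_closed)

lemma conjug_image_mult_left:
  "g \<in> carrier G \<Longrightarrow> h \<in> carrier G \<Longrightarrow> A \<subseteq> carrier G \<Longrightarrow>
     conjug (g \<otimes> h) ` A = conjug g ` conjug h ` A"
  by (auto simp: image_iff subset_iff conjug_mult_left)

lemma conjug_image_by_one: "A \<subseteq> carrier G \<Longrightarrow> conjug \<one> ` A = A"
  by (force simp: image_iff)

lemma conjug_image_inv_cancel:
  assumes "g \<in> carrier G" "A \<subseteq> carrier G"
  shows "conjug (inv g) ` conjug g ` A = A" "conjug g ` conjug (inv g) ` A = A"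
  using assms by (simp_all add: conjug_image_by_one flip: conjug_image_mult_left)

lemma conjug_image_closed: "g \<in> carrier G \<Longrightarrow> A \<subseteq> carrier G \<Longrightarrow> conjug g ` A \<subseteq> carrier G"
  by auto

lemma conjug_mem_image_iff:
  assumes "g \<in> carrier G" "A \<subseteq> carrier G" "x \<in> carrier G"
  shows "x \<in> conjug g ` A \<longleftrightarrow> conjug (inv g) x \<in> A"
proof
  assume "x \<in> conjug g ` A"
  then obtain a where "a \<in> A" "x = conjug g a" by blast
  then show "conjug (inv g) x \<in> A" using assms by auto
next
  assume "conjug (inv g) x \<in> A"
  moreover have "x = conjug g (conjug (inv g) x)" using assms by simp
  ultimately show "x \<in> conjug g ` A" by blast
qed

lemma inj_on_conjug: "g \<in> carrier G \<Longrightarrow> inj_on (conjug g) (carrier G)"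
  by (rule inj_on_inverseI[where g = "conjug (inv g)"]) simp

lemma group_hom_conjug:
  assumes "g \<in> carrier G"
  shows "group_hom G G (conjug g)"
  using assms by unfold_locales (auto simp: hom_def conjug_mult)

lemma subgroup_conjug_image:
  assumes "subgroup A G" "g \<in> carrier G"
  shows "subgroup (conjug g ` A) G"
  using group_hom.subgroup_img_is_subgroup[OF group_hom_conjug[OF assms(2)] assms(1)] .

lemma conjug_mem_subgroup:
  assumes "subgroup A G" "g \<in> A" "x \<in> A"
  shows "conjug g x \<in> A"
  using assms by (simp add: conjug_def subgroup.m_closed subgroup.m_inv_closed)

lemma conjug_image_subgroup:
  assumes "subgroup A G" "g \<in> A"
  shows "conjug g ` A = A"
proof -
  have g: "g \<in> carrier G" and A: "A \<subseteq> carrier G"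
    using assms subgroup.subset by blast+
  have "x \<in> conjug g ` A" if "x \<in> A" for x
    using that assms g A
    by (subst conjug_mem_image_iff) (auto intro: conjug_mem_subgroup subgroup.m_inv_closed)
  then show ?thesis using assms by (auto intro: conjug_mem_subgroup)
qed

text \<open>\<open>Y\<close> contains inverses, so \<open>conjug (inv g)\<close> also maps
  \<open>A\<close> into itself, which supplies the reverse inclusion.\<close>

lemma conjug_image_eqI:
  assumes "subgroup Y G" "A \<subseteq> carrier G" "\<And>g a. g \<in> Y \<Longrightarrow> a \<in> A \<Longrightarrow> conjug g a \<in> A" "g \<in> Y"
  shows "conjug g ` A = A"
proof -
  have g: "g \<in> carrier G" using assms subgroup.subset by blast
  have "x \<in> conjug g ` A" if "x \<in> A" for x
    using that assms g by (subst conjug_mem_image_iff) (auto intro: subgroup.m_inv_closed)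
  then show ?thesis using assms by auto
qed

lemma conjug_image_eq_if_subset:
  assumes "finite A" "A \<subseteq> carrier G" "g \<in> carrier G" "conjug g ` A \<subseteq> A"
  shows "conjug g ` A = A"
proof -
  have "inj_on (conjug g) A"
    using inj_on_conjug[OF assms(3)] assms(2) by (rule inj_on_subset)
  then have "card (conjug g ` A) = card A" by (rule card_image)
  with assms(1,4) show ?thesis by (rule card_subset_eq)
qed

section \<open>Products of subgroups and generated subgroups\<close>

lemma set_mult_memI: "a \<in> A \<Longrightarrow> b \<in> B \<Longrightarrow> a \<otimes> b \<in> A <#> B"
  by (auto simp: set_mult_def)

lemma subgroup_set_mult:
  assumes A: "subgroup A G" and B: "subgroup B G"
    and norm: "\<And>a b. a \<in> A \<Longrightarrow> b \<in> B \<Longrightarrow> conjug a b \<in> B"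
  shows "subgroup (A <#> B) G"
proof (rule subgroupI)
  note sub = subgroup.mem_carrier[OF A] subgroup.mem_carrier[OF B]
  show "A <#> B \<subseteq> carrier G" by (auto simp: set_mult_def sub)
  show "A <#> B \<noteq> {}"
    using subgroup.one_closed[OF A] subgroup.one_closed[OF B] by (auto simp: set_mult_def)
  show "inv x \<in> A <#> B" if x: "x \<in> A <#> B" for x
  proof -
    obtain a b where ab: "a \<in> A" "b \<in> B" "x = a \<otimes> b" using x by (auto simp: set_mult_def)
    have "inv x = inv a \<otimes> conjug a (inv b)"
      using ab sub by (simp add: conjug_def m_assoc inv_mult_group)
    then show ?thesis
      using ab norm subgroup.m_inv_closed[OF A] subgroup.m_inv_closed[OF B]
      by (simp add: set_mult_memI)
  qed
  show "x \<otimes> y \<in> A <#> B" if xy: "x \<in> A <#> B" "y \<in> A <#> B" for x y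
  proof -
    obtain a b c d where ab: "a \<in> A" "b \<in> B" "x = a \<otimes> b" "c \<in> A" "d \<in> B" "y = c \<otimes> d"
      using xy by (auto simp: set_mult_def)
    \<comment> \<open>Moving \<open>c\<close> to the left past \<open>b\<close> conjugates
      \<open>b\<close> by \<open>inv c\<close>, which keeps it in \<open>B\<close>.\<close>
    have "x \<otimes> y = (a \<otimes> c) \<otimes> (conjug (inv c) b \<otimes> d)"
      using ab sub by (simp add: conjug_def m_assoc)
    then show ?thesis
      using ab norm subgroup.m_inv_closed[OF A] subgroup.m_closed[OF A] subgroup.m_closed[OF B]
      by (simp add: set_mult_memI)
  qed
qed

lemma set_mult_subgroup_subset:
  assumes "subgroup A G" "subgroup B G"
  shows "A \<subseteq> A <#> B" "B \<subseteq> A <#> B"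
proof -
  show "A \<subseteq> A <#> B"
    using set_mult_memI[of _ A \<one> B] subgroup.one_closed[OF assms(2)] subgroup.mem_carrier[OF assms(1)]
    by fastforce
  show "B \<subseteq> A <#> B"
    using set_mult_memI[of \<one> A _ B] subgroup.one_closed[OF assms(1)] subgroup.mem_carrier[OF assms(2)]
    by fastforce
qed

lemma conjug_image_set_mult:
  assumes "g \<in> carrier G" "A \<subseteq> carrier G" "B \<subseteq> carrier G"
  shows "conjug g ` (A <#> B) = conjug g ` A <#> conjug g ` B"
  using assms by (force simp: set_mult_def image_iff conjug_mult subset_iff)

lemma conjug_generate:
  assumes "g \<in> carrier G" "A \<subseteq> carrier G"
  shows "conjug g ` generate G A = generate G (conjug g ` A)"
  using group_hom.generate_img[OF group_hom_conjug[OF assms(1)] assms(2)] by simp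

lemma commute_generate:
  assumes "A \<subseteq> carrier G" "x \<in> carrier G" "\<And>a. a \<in> A \<Longrightarrow> conjug a x = x" "y \<in> generate G A"
  shows "conjug y x = x"
  using assms(4)
proof induct
  case (inv h)
  then show ?case using assms by (metis conjug_inv_cancel(1) subsetD)
next
  case (eng y z)
  then have "y \<in> carrier G" "z \<in> carrier G" using assms(1) generate_in_carrier by blast+
  then show ?case using eng assms(2) by (simp add: conjug_mult_left)
qed (use assms in auto)

section \<open>Minimal invariant subgroups\<close>

text \<open>One notion for three uses: \<open>Y = carrier G\<close> gives minimal normal subgroups,
  \<open>Y = N\<close> with \<open>A\<close> inside a subgroup \<open>N\<close> gives minimal normal
  subgroups of \<open>N\<close>, and \<open>Y = A\<close> expresses simplicity of
  \<open>A\<close>.\<close>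

definition minimal_invariant :: "'a set \<Rightarrow> 'a set \<Rightarrow> bool" where
  "minimal_invariant Y A \<longleftrightarrow> subgroup A G \<and> A \<noteq> {\<one>} \<and> (\<forall>g\<in>Y. conjug g ` A \<subseteq> A) \<and>
     (\<forall>B. subgroup B G \<longrightarrow> B \<subseteq> A \<longrightarrow> (\<forall>g\<in>Y. conjug g ` B \<subseteq> B) \<longrightarrow> B = {\<one>} \<or> B = A)"

lemma minimal_invariant_subgroup: "minimal_invariant Y A \<Longrightarrow> subgroup A G"
  by (simp add: minimal_invariant_def)

lemma minimal_invariant_nontrivial: "minimal_invariant Y A \<Longrightarrow> A \<noteq> {\<one>}"
  by (simp add: minimal_invariant_def)

lemma minimal_invariant_closed:
  "minimal_invariant Y A \<Longrightarrow> g \<in> Y \<Longrightarrow> a \<in> A \<Longrightarrow> conjug g a \<in> A"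
  by (auto simp: minimal_invariant_def image_subset_iff)

lemma minimal_invariantD:
  assumes "minimal_invariant Y A" "subgroup B G" "B \<subseteq> A"
    and "\<And>g b. g \<in> Y \<Longrightarrow> b \<in> B \<Longrightarrow> conjug g b \<in> B"
  shows "B = {\<one>} \<or> B = A"
  using assms by (simp add: minimal_invariant_def image_subset_iff)

text \<open>Descent on the order: if \<open>A\<close> is not minimal, a nontrivial invariant proper
  subgroup of it has smaller order.\<close>

lemma minimal_invariant_exists:
  assumes "subgroup A G" "finite A" "A \<noteq> {\<one>}" "\<forall>g\<in>Y. conjug g ` A \<subseteq> A"
  shows "\<exists>B \<subseteq> A. minimal_invariant Y B"
  using assms
proof (induction "card A" arbitrary: A rule: less_induct)
  case less
  show ?case
  proof (cases "minimal_invariant Y A")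
    case False
    then obtain B where B: "subgroup B G" "B \<subseteq> A" "\<forall>g\<in>Y. conjug g ` B \<subseteq> B" "B \<noteq> {\<one>}" "B \<noteq> A"
      using less.prems unfolding minimal_invariant_def by blast
    have "finite B" using B(2) less.prems(2) by (rule finite_subset)
    moreover have "card B < card A"
      by (rule psubset_card_mono[OF less.prems(2)]) (use B(2,5) in blast)
    ultimately obtain C where "C \<subseteq> B" "minimal_invariant Y C"
      using less.hyps[OF _ B(1) _ B(4,3)] by blast
    then show ?thesis using B(2) by blast
  qed auto
qed

text \<open>Conjugation by \<open>g\<close> is an automorphism of \<open>G\<close> that preserves
  \<open>Y\<close> in both directions, so it carries \<open>Y\<close>-invariant subgroups to
  \<open>Y\<close>-invariant subgroups, and its inverse pulls any competitor back below
  \<open>A\<close>.\<close>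

lemma minimal_invariant_conjug:
  assumes "minimal_invariant Y A" "g \<in> carrier G" "Y \<subseteq> carrier G"
    and "conjug (inv g) ` Y \<subseteq> Y" "conjug g ` Y \<subseteq> Y"
  shows "minimal_invariant Y (conjug g ` A)"
proof -
  have A: "subgroup A G" "A \<noteq> {\<one>}" "\<forall>x\<in>Y. conjug x ` A \<subseteq> A"
    and min: "\<And>B. subgroup B G \<Longrightarrow> B \<subseteq> A \<Longrightarrow> (\<forall>g\<in>Y. conjug g ` B \<subseteq> B) \<Longrightarrow> B = {\<one>} \<or> B = A"
    using assms(1) unfolding minimal_invariant_def by blast+
  note Ac = subgroup.subset[OF A(1)]
  \<comment> \<open>Conjugating by \<open>h\<close> and then by \<open>x\<close> is conjugating by
    \<open>inv h \<otimes> x \<otimes> h\<close>, again in \<open>Y\<close>, and then by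
    \<open>h\<close>. This is applied with \<open>h = g\<close> to \<open>A\<close> and with
    \<open>h = inv g\<close> to a competitor.\<close>
  have transport: "conjug x ` conjug h ` B \<subseteq> conjug h ` B"
    if h: "h \<in> carrier G" "conjug (inv h) ` Y \<subseteq> Y" and B: "B \<subseteq> carrier G" "\<forall>x\<in>Y. conjug x ` B \<subseteq> B"
      and x: "x \<in> Y" for h B x
  proof -
    have xc: "x \<in> carrier G" using x assms(3) by blast
    have *: "conjug (inv h) x \<in> Y" using h x by blast
    have "conjug x (conjug h b) \<in> conjug h ` B" if "b \<in> B" for b
    proof -
      have "b \<in> carrier G" using that B by blast
      then have "conjug x (conjug h b) = conjug h (conjug (conjug (inv h) x) b)" using h(1) xc
        by (simp add: conjug_def m_assoc inv_mult_group)
      then show ?thesis using that * B(2) by blast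
    qed
    then show ?thesis by blast
  qed
  have "conjug g ` A \<noteq> {\<one>}"
  proof
    assume "conjug g ` A = {\<one>}"
    then have "a = \<one>" if "a \<in> A" for a
      using that Ac assms(2) conjug_eq_one_iff[of g a] by blast
    then show False using A(2) subgroup.one_closed[OF A(1)] by blast
  qed
  moreover have "B = {\<one>} \<or> B = conjug g ` A"
    if B: "subgroup B G" "B \<subseteq> conjug g ` A" "\<forall>g\<in>Y. conjug g ` B \<subseteq> B" for B
  proof -
    note Bc = subgroup.subset[OF B(1)]
    have "conjug (inv g) ` B \<subseteq> A"
      using image_mono[OF B(2), of "conjug (inv g)"] conjug_image_inv_cancel(1)[OF assms(2) Ac] by simp
    moreover have "\<forall>x\<in>Y. conjug x ` conjug (inv g) ` B \<subseteq> conjug (inv g) ` B"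
      using transport[of "inv g" B] assms(2,5) B Bc by auto
    ultimately have "conjug (inv g) ` B = {\<one>} \<or> conjug (inv g) ` B = A"
      using min[OF subgroup_conjug_image[OF B(1)]] assms(2) by simp
    then show ?thesis
    proof
      assume *: "conjug (inv g) ` B = {\<one>}"
      have "B = conjug g ` conjug (inv g) ` B" using conjug_image_inv_cancel(2)[OF assms(2) Bc] by simp
      then show ?thesis using * assms(2) by simp
    qed (use conjug_image_inv_cancel(2)[OF assms(2) Bc] in auto)
  qed
  ultimately show ?thesis
    unfolding minimal_invariant_def
    using subgroup_conjug_image[OF A(1) assms(2)] transport[OF assms(2,4) Ac A(3)] by simp
qed

text \<open>The intersection is invariant, hence trivial by the two minimalities. Since
  \<open>A\<close> and \<open>B\<close> lie in \<open>Y\<close>, they normalise each other, so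
  commutators fall into the intersection.\<close>

lemma minimal_invariant_commute:
  assumes A: "minimal_invariant Y A" "A \<subseteq> Y" and B: "minimal_invariant Y B" "B \<subseteq> Y"
    and "A \<noteq> B" "a \<in> A" "b \<in> B"
  shows "conjug a b = b"
proof -
  note sub = minimal_invariant_subgroup[OF A(1)] minimal_invariant_subgroup[OF B(1)]
  note inv = minimal_invariant_closed[OF A(1)] minimal_invariant_closed[OF B(1)]
  have c: "a \<in> carrier G" "b \<in> carrier G"
    using subgroup.mem_carrier[OF sub(1) assms(6)] subgroup.mem_carrier[OF sub(2) assms(7)] .
  have I: "A \<inter> B = {\<one>}"
  proof (rule ccontr)
    assume ne: "A \<inter> B \<noteq> {\<one>}"
    have "subgroup (A \<inter> B) G" using sub by (rule subgroups_Inter_pair)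
    moreover have "conjug g b \<in> A \<inter> B" if "g \<in> Y" "b \<in> A \<inter> B" for g b
      using inv that by blast
    ultimately have "A \<inter> B = A" "A \<inter> B = B"
      using minimal_invariantD[OF A(1), of "A \<inter> B"] minimal_invariantD[OF B(1), of "A \<inter> B"] ne
      by auto
    then show False using assms(5) by blast
  qed
  \<comment> \<open>The commutator of \<open>a\<close> and \<open>b\<close>, bracketed once as an
    element of \<open>B\<close> and once as an element of \<open>A\<close>.\<close>
  have "conjug a b \<otimes> inv b \<in> B"
    using assms sub(2) inv(2)[of a b]
    by (intro subgroup.m_closed[OF sub(2)] subgroup.m_inv_closed[OF sub(2)]) auto
  moreover have "conjug a b \<otimes> inv b = a \<otimes> conjug b (inv a)"
    using c by (simp add: conjug_def m_assoc)
  moreover have "a \<otimes> conjug b (inv a) \<in> A"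
    using assms inv(1)[of b "inv a"] subgroup.m_inv_closed[OF sub(1)]
    by (intro subgroup.m_closed[OF sub(1)]) auto
  ultimately have "conjug a b \<otimes> inv b = \<one>" using I by auto
  then show ?thesis using c by (metis conjug_closed inv_closed inv_equality inv_inv)
qed

end

section \<open>Primitive actions without regular subgroups\<close>

text \<open>The failure of weak-EKR enters through \<open>no_regular\<close> alone; the passage from
  one to the other is \<open>weak_EKR_if_regular\<close>.\<close>

locale primitive_without_regular = faithful_action G \<Omega> \<phi> for G :: "('a, 'm) monoid_scheme" (structure) and \<Omega> :: "'b set" and \<phi> +
  assumes finite_carrier: "finite (carrier G)"
    and primitive: "primitive_action G \<Omega> \<phi>"
    and no_regular: "\<And>R. subgroup R G \<Longrightarrow> (\<forall>x\<in>\<Omega>. \<forall>y\<in>\<Omega>. \<exists>r\<in>R. \<phi> r x = y) \<Longrightarrow>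
        (\<forall>r\<in>R. \<forall>x\<in>\<Omega>. \<phi> r x = x \<longrightarrow> r = \<one>) \<Longrightarrow> False"

sublocale primitive_without_regular \<subseteq> group G
  using group_hom by (simp add: group_hom_def)

context primitive_without_regular
begin

abbreviation stab :: "'b \<Rightarrow> 'a set" where
  "stab \<equiv> stabilizer G \<phi>"

lemma act_closed: "g \<in> carrier G \<Longrightarrow> x \<in> \<Omega> \<Longrightarrow> \<phi> g x \<in> \<Omega>"
  using element_image by blast

lemma act_mult: "g \<in> carrier G \<Longrightarrow> h \<in> carrier G \<Longrightarrow> x \<in> \<Omega> \<Longrightarrow> \<phi> (g \<otimes> h) x = \<phi> g (\<phi> h x)"
  by (rule composition_rule)

lemma act_one: "x \<in> \<Omega> \<Longrightarrow> \<phi> \<one> x = x"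
  by (simp flip: id_eq_one)

lemma act_inv:
  assumes "g \<in> carrier G" "x \<in> \<Omega>"
  shows "\<phi> (inv g) (\<phi> g x) = x" "\<phi> g (\<phi> (inv g) x) = x"
  using assms by (simp_all add: act_one flip: act_mult)

lemma act_conjug:
  assumes "g \<in> carrier G" "h \<in> carrier G" "x \<in> \<Omega>"
  shows "\<phi> (conjug g h) (\<phi> g x) = \<phi> g (\<phi> h x)"
  using assms by (simp add: conjug_def act_mult act_inv act_closed)

lemma act_eq_one:
  assumes "g \<in> carrier G" "\<And>x. x \<in> \<Omega> \<Longrightarrow> \<phi> g x = x"
  shows "g = \<one>"
proof -
  have "\<phi> g x = \<phi> \<one> x" for x
  proof (cases "x \<in> \<Omega>")
    \<comment> \<open>Outside \<Omega> both maps are \<open>undefined\<close>, because members of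
      \<open>Bij\<close> are extensional.\<close>
    case False
    then show ?thesis
      using bij_prop0[OF assms(1)] bij_prop0[OF one_closed]
      by (auto simp: Bij_def extensional_def)
  qed (simp add: assms(2) act_one)
  then have "\<phi> g = \<phi> \<one>" by blast
  then show ?thesis using inj_onD[OF faithful] assms(1) by blast
qed

lemma act_transitive: "x \<in> \<Omega> \<Longrightarrow> y \<in> \<Omega> \<Longrightarrow> \<exists>g\<in>carrier G. \<phi> g x = y"
  using primitive by (auto simp: primitive_action_def transitive_action_def transitive_action_axioms_def)

lemma stab_iff: "g \<in> stab x \<longleftrightarrow> g \<in> carrier G \<and> \<phi> g x = x"
  by (simp add: stabilizer_def)

lemma stab_subgroup: "x \<in> \<Omega> \<Longrightarrow> subgroup (stab x) G"
  by (rule stabilizer_subgroup)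

lemma stab_maximal:
  assumes "x \<in> \<Omega>" "subgroup K G" "stab x \<subseteq> K"
  shows "K = stab x \<or> K = carrier G"
  using primitive assms by (auto simp: primitive_action_def maximal_subgroup_def)

lemma stab_conjug:
  assumes "g \<in> carrier G" "x \<in> \<Omega>" "h \<in> stab x"
  shows "conjug g h \<in> stab (\<phi> g x)"
  using assms by (auto simp: stab_iff act_conjug)

text \<open>The stabiliser normalises \<open>A\<close>, so their product is a subgroup above a
  maximal subgroup.\<close>

lemma invariant_subgroup_cases:
  assumes x: "x \<in> \<Omega>" and A: "subgroup A G" "\<And>h a. h \<in> stab x \<Longrightarrow> a \<in> A \<Longrightarrow> conjug h a \<in> A"
  shows "A \<subseteq> stab x \<or> stab x <#> A = carrier G"
proof -
  have "subgroup (stab x <#> A) G"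
    by (rule subgroup_set_mult[OF stab_subgroup[OF x] A])
  then have "stab x <#> A = stab x \<or> stab x <#> A = carrier G"
    using stab_maximal[OF x] set_mult_subgroup_subset(1)[OF stab_subgroup[OF x] A(1)] by blast
  then show ?thesis
    using set_mult_subgroup_subset(2)[OF stab_subgroup[OF x] A(1)] by auto
qed

text \<open>A normal subgroup inside one stabiliser lies in all of them and is trivial by
  faithfulness. Otherwise \<open>G\<close> is the product of the stabiliser of \<open>y\<close> and
  \<open>N\<close>; in an element taking \<open>x\<close> to \<open>y\<close>, the first factor
  fixes \<open>y\<close>, so the factor from \<open>N\<close> already takes \<open>x\<close> to
  \<open>y\<close>.\<close>

lemma normal_transitive:
  assumes N: "subgroup N G" "N \<noteq> {\<one>}" "\<And>g n. g \<in> carrier G \<Longrightarrow> n \<in> N \<Longrightarrow> conjug g n \<in> N"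
    and x: "x \<in> \<Omega>" and y: "y \<in> \<Omega>"
  shows "\<exists>n\<in>N. \<phi> n x = y"
proof -
  note Nc = subgroup.mem_carrier[OF N(1)]
  have "\<not> N \<subseteq> stab y"
  proof
    assume sub: "N \<subseteq> stab y"
    have "n = \<one>" if n: "n \<in> N" for n
    proof (rule act_eq_one)
      fix z assume z: "z \<in> \<Omega>"
      obtain g where g: "g \<in> carrier G" "\<phi> g y = z" using act_transitive[OF y z] by blast
      have "conjug (inv g) n \<in> stab y" using N(3)[of "inv g" n] g n sub by auto
      from stab_conjug[OF g(1) y this] show "\<phi> n z = z"
        using g Nc[OF n] by (simp add: stab_iff)
    qed (rule Nc[OF n])
    then show False using N(2) subgroup.one_closed[OF N(1)] by blast
  qed
  moreover have "conjug h n \<in> N" if "h \<in> stab y" "n \<in> N" for h n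
    using N(3) that by (simp add: stab_iff)
  ultimately have prod: "stab y <#> N = carrier G"
    using invariant_subgroup_cases[OF y N(1)] by blast
  obtain g where g: "g \<in> carrier G" "\<phi> g x = y" using act_transitive[OF x y] by blast
  have "g \<in> stab y <#> N" using g(1) prod by simp
  then obtain h n where hn: "h \<in> stab y" "n \<in> N" "g = h \<otimes> n"
    unfolding set_mult_def by blast
  have h: "h \<in> carrier G" "\<phi> h y = y" using hn by (auto simp: stab_iff)
  have "\<phi> h (\<phi> n x) = \<phi> h y"
    using g hn Nc h x by (simp add: act_mult)
  then have "\<phi> n x = y"
    using inj_prop[OF h(1)] act_closed[OF Nc[OF hn(2)] x] y by (auto dest: inj_onD)
  then show ?thesis using hn by blast
qed

text \<open>The centraliser \<open>C\<close> is normal, so if nontrivial it is transitive; commuting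
  with the transitive group \<open>N\<close> makes it semiregular. It would then be a regular
  subgroup.\<close>

lemma centralizer_trivial:
  assumes N: "subgroup N G" "N \<noteq> {\<one>}" "\<And>g n. g \<in> carrier G \<Longrightarrow> n \<in> N \<Longrightarrow> conjug g n \<in> N"
    and c: "c \<in> carrier G" "\<And>n. n \<in> N \<Longrightarrow> conjug c n = n"
  shows "c = \<one>"
proof -
  note Nc = subgroup.mem_carrier[OF N(1)]
  define C where "C = {c \<in> carrier G. \<forall>n\<in>N. conjug c n = n}"
  have C: "subgroup C G"
  proof (rule subgroupI)
    show "C \<noteq> {}" using Nc by (auto simp: C_def intro!: exI[of _ \<one>])
    show "inv a \<in> C" if a: "a \<in> C" for a
    proof -
      have "conjug (inv a) n = n" if "n \<in> N" for n
        using a that Nc conjug_inv_cancel(1)[of a n] by (simp add: C_def)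
      then show ?thesis using a by (simp add: C_def)
    qed
    show "a \<otimes> b \<in> C" if "a \<in> C" "b \<in> C" for a b
      using that Nc by (simp add: C_def conjug_mult_left)
  qed (simp add: C_def)
  have normal: "conjug g a \<in> C" if g: "g \<in> carrier G" and a: "a \<in> C" for g a
  proof -
    have "conjug (conjug g a) n = n" if n: "n \<in> N" for n
    proof -
      have ac: "a \<in> carrier G" using a by (simp add: C_def)
      have "conjug (conjug g a) n = conjug g (conjug a (conjug (inv g) n))"
        using g ac Nc[OF n] by (simp add: conjug_def m_assoc inv_mult_group)
      also have "conjug a (conjug (inv g) n) = conjug (inv g) n"
        using a N(3)[of "inv g" n] g n by (simp add: C_def)
      finally show ?thesis using g Nc[OF n] by simp
    qed
    then show ?thesis using g a by (simp add: C_def)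
  qed
  have "C = {\<one>}"
  proof (rule ccontr)
    assume ne: "C \<noteq> {\<one>}"
    \<comment> \<open>If \<open>a\<close> fixes \<open>x\<close>, it fixes every
      \<open>\<phi> n x\<close> with \<open>n\<close> in \<open>N\<close>, and these are all
      points.\<close>
    have "a = \<one>" if a: "a \<in> C" and x: "x \<in> \<Omega>" and fx: "\<phi> a x = x" for a x
    proof (rule act_eq_one)
      show ac: "a \<in> carrier G" using a by (simp add: C_def)
      fix y assume "y \<in> \<Omega>"
      then obtain n where n: "n \<in> N" "\<phi> n x = y" using normal_transitive[OF N x] by blast
      have "\<phi> (conjug a n) (\<phi> a x) = \<phi> a (\<phi> n x)"
        using act_conjug[OF ac Nc[OF n(1)] x] .
      then show "\<phi> a y = y" using a n fx by (simp add: C_def)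
    qed
    then show False
      using no_regular[OF C] normal_transitive[OF C ne normal] by blast
  qed
  moreover have "c \<in> C" using c by (simp add: C_def)
  ultimately show ?thesis by blast
qed

end

section \<open>The simple factors of a minimal normal subgroup\<close>

locale minimal_normal = primitive_without_regular +
  fixes N T w
  assumes N: "minimal_invariant (carrier G) N"
    and T: "minimal_invariant N T" "T \<subseteq> N"
    and w: "w \<in> \<Omega>"
begin

lemmas N_subgroup = minimal_invariant_subgroup[OF N]
lemmas N_carrier = subgroup.mem_carrier[OF N_subgroup]
lemmas N_nontrivial = minimal_invariant_nontrivial[OF N]
lemmas N_normal = minimal_invariant_closed[OF N]
lemmas T_subgroup = minimal_invariant_subgroup[OF T(1)]

lemma N_transitive: "x \<in> \<Omega> \<Longrightarrow> y \<in> \<Omega> \<Longrightarrow> \<exists>n\<in>N. \<phi> n x = y"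
  using normal_transitive[OF N_subgroup N_nontrivial N_normal] by blast

section \<open>Conjugates of \<open>T\<close> and the direct decomposition of
  \<open>N\<close>\<close>

definition factors :: "'a set set" where
  "factors = (\<lambda>g. conjug g ` T) ` carrier G"

text \<open>The product of the factors in \<open>J\<close>. Defining it by generation avoids
  ordering the factors and makes the empty product trivial.\<close>

definition gen :: "'a set set \<Rightarrow> 'a set" where
  "gen J = generate G (\<Union>J)"

lemma finite_factors: "finite factors"
  by (simp add: factors_def finite_carrier)

lemma T_factor: "T \<in> factors"
proof -
  have "conjug \<one> ` T = T"
    using subgroup.subset[OF T_subgroup] by (rule conjug_image_by_one)
  then show ?thesis unfolding factors_def by (metis image_eqI one_closed)
qed

lemma factor_subset_N: "i \<in> factors \<Longrightarrow> i \<subseteq> N"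
  using T(2) N_normal by (auto simp: factors_def)

lemma factor_minimal: 
  assumes "i \<in> factors"
  shows "minimal_invariant N i"
proof -
  obtain g where g: "g \<in> carrier G" "i = conjug g ` T"
    using assms by (auto simp: factors_def)
  show ?thesis unfolding g(2)
    by (rule minimal_invariant_conjug[OF T(1) g(1)]) (use N_carrier N_normal g(1) in auto)
qed

lemma factor_subgroup: "i \<in> factors \<Longrightarrow> subgroup i G"
  using factor_minimal minimal_invariant_subgroup by blast

lemma factor_conjug:
  assumes "i \<in> factors" "g \<in> carrier G"
  shows "conjug g ` i \<in> factors"
proof -
  obtain h where h: "h \<in> carrier G" "i = conjug h ` T"
    using assms by (auto simp: factors_def)
  have "conjug g ` i = conjug (g \<otimes> h) ` T"
    unfolding h(2) using conjug_image_mult_left[OF assms(2) h(1) subgroup.subset[OF T_subgroup]] by simp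
  then show ?thesis using assms(2) h(1) by (auto simp: factors_def)
qed

lemma conjug_image_factors:
  assumes "g \<in> carrier G"
  shows "(`) (conjug g) ` factors = factors"
proof
  show "(`) (conjug g) ` factors \<subseteq> factors" using factor_conjug[OF _ assms] by blast
  show "factors \<subseteq> (`) (conjug g) ` factors"
  proof
    fix i assume i: "i \<in> factors"
    have "i = conjug g ` conjug (inv g) ` i"
      using conjug_image_inv_cancel(2)[OF assms subgroup.subset[OF factor_subgroup[OF i]]] by simp
    then show "i \<in> (`) (conjug g) ` factors"
      using factor_conjug[OF i, of "inv g"] assms by blast
  qed
qed

lemma factor_commute:
  assumes "i \<in> factors" "j \<in> factors" "i \<noteq> j" "a \<in> i" "b \<in> j"
  shows "conjug a b = b"
  by (rule minimal_invariant_commute[OF factor_minimal[OF assms(1)] factor_subset_N[OF assms(1)]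
        factor_minimal[OF assms(2)] factor_subset_N[OF assms(2)] assms(3-5)])

lemma Union_carrier: "J \<subseteq> factors \<Longrightarrow> \<Union>J \<subseteq> carrier G"
  using factor_subset_N N_carrier by blast

lemma gen_subgroup: "J \<subseteq> factors \<Longrightarrow> subgroup (gen J) G"
  unfolding gen_def by (rule generate_is_subgroup[OF Union_carrier])

lemma gen_carrier: "J \<subseteq> factors \<Longrightarrow> a \<in> gen J \<Longrightarrow> a \<in> carrier G"
  by (rule subgroup.mem_carrier[OF gen_subgroup])

lemma gen_mono: "J \<subseteq> J' \<Longrightarrow> gen J \<subseteq> gen J'"
  unfolding gen_def by (rule mono_generate) blast

lemma factor_subset_gen: "i \<in> J \<Longrightarrow> i \<subseteq> gen J"
  by (auto simp: gen_def intro: generate.incl)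

lemma gen_subset_N: "J \<subseteq> factors \<Longrightarrow> gen J \<subseteq> N"
  unfolding gen_def by (rule generate_subgroup_incl[OF _ N_subgroup]) (use factor_subset_N in blast)

lemma gen_conjug:
  assumes "g \<in> carrier G" "J \<subseteq> factors"
  shows "conjug g ` gen J = gen ((`) (conjug g) ` J)"
  unfolding gen_def conjug_generate[OF assms(1) Union_carrier[OF assms(2)]] by (simp add: image_Union)

text \<open>Conjugation permutes the factors injectively, so it commutes with leaving one of them
  out. This is how \<open>G\<close> permutes the coordinates later.\<close>

lemma gen_complement_conjug:
  assumes g: "g \<in> carrier G" and i: "i \<in> factors"
  shows "conjug g ` gen (factors - {i}) = gen (factors - {conjug g ` i})"
proof -
  have "inj_on ((`) (conjug g)) factors"
    using inj_on_image_Pow[OF inj_on_conjug[OF g]]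
    by (rule inj_on_subset) (use factor_subgroup subgroup.subset in blast)
  from inj_on_image_set_diff[OF this, of factors "{i}"] show ?thesis
    using i by (simp add: gen_conjug[OF g] conjug_image_factors[OF g])
qed

text \<open>\<open>N\<close> normalises each factor separately, so it fixes every subset of
  \<open>factors\<close> elementwise.\<close>

lemma gen_N_normal:
  assumes "J \<subseteq> factors" "n \<in> N" "a \<in> gen J"
  shows "conjug n a \<in> gen J"
proof -
  have "conjug n ` i = i" if "i \<in> J" for i
  proof (rule conjug_image_eqI[OF N_subgroup _ _ assms(2)])
    show "i \<subseteq> carrier G" using that assms(1) Union_carrier by blast
    show "conjug g a \<in> i" if "g \<in> N" "a \<in> i" for g a
      using that \<open>i \<in> J\<close> minimal_invariant_closed[OF factor_minimal] assms(1) by blast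
  qed
  then have "(`) (conjug n) ` J = J" by simp
  then have "conjug n ` gen J = gen J"
    using gen_conjug[OF N_carrier[OF assms(2)] assms(1)] by simp
  then show ?thesis using imageI[OF assms(3), of "conjug n"] by simp
qed

text \<open>Distinct factors commute. This extends from generators to \<open>gen J\<close> with an
  element of \<open>\<Union>J'\<close> fixed, and then, by symmetry of commuting, to
  \<open>gen J'\<close>.\<close>

lemma gen_commute:
  assumes "J \<subseteq> factors" "J' \<subseteq> factors" "J \<inter> J' = {}" "a \<in> gen J" "b \<in> gen J'"
  shows "conjug a b = b"
proof -
  note Jc = Union_carrier[OF assms(1)] and Jc' = Union_carrier[OF assms(2)]
  have 1: "conjug a b = b" if ab: "a \<in> \<Union>J" "b \<in> \<Union>J'" for a b
  proof -
    obtain i j where ij: "i \<in> J" "a \<in> i" "j \<in> J'" "b \<in> j" using ab by blast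
    then have "i \<in> factors" "j \<in> factors" "i \<noteq> j" using assms(1-3) by blast+
    from factor_commute[OF this ij(2,4)] show ?thesis .
  qed
  have ac: "a \<in> carrier G" and bc: "b \<in> carrier G"
    using gen_carrier assms by blast+
  have "conjug a x = x" if x: "x \<in> \<Union>J'" for x
    using commute_generate[OF Jc, of x a] 1[OF _ x] x Jc' assms(4) by (auto simp: gen_def)
  then have "conjug x a = a" if "x \<in> \<Union>J'" for x
    using that conjug_fixed_iff[of a x] conjug_fixed_iff[of x a] ac Jc' by force
  then have "conjug b a = a"
    using commute_generate[OF Jc' ac] assms(5) by (simp add: gen_def)
  then show ?thesis
    using conjug_fixed_iff[of a b] conjug_fixed_iff[of b a] ac bc by force
qed

text \<open>The conjugates of \<open>T\<close> are permuted by \<open>G\<close>, so they generate a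
  nontrivial normal subgroup inside the minimal normal subgroup \<open>N\<close>.\<close>

lemma gen_factors: "gen factors = N"
proof -
  have "gen factors = {\<one>} \<or> gen factors = N"
  proof (rule minimal_invariantD[OF N])
    show "conjug g b \<in> gen factors" if "g \<in> carrier G" "b \<in> gen factors" for g b
      using gen_conjug[OF that(1) subset_refl] imageI[OF that(2), of "conjug g"] that(1)
      by (simp add: conjug_image_factors)
  qed (simp_all add: gen_subgroup gen_subset_N)
  moreover have "gen factors \<noteq> {\<one>}"
  proof
    assume "gen factors = {\<one>}"
    then have "T \<subseteq> {\<one>}" using factor_subset_gen[OF T_factor] by simp
    then show False
      using minimal_invariant_nontrivial[OF T(1)] subgroup.one_closed[OF T_subgroup] by blast
  qed
  ultimately show ?thesis by blast
qed

lemma gen_insert: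
  assumes "i \<in> factors" "J \<subseteq> factors" "x \<in> gen (insert i J)"
  obtains a b where "a \<in> i" "b \<in> gen J" "x = a \<otimes> b"
proof -
  have sub: "subgroup (i <#> gen J) G"
  proof (rule subgroup_set_mult[OF factor_subgroup[OF assms(1)] gen_subgroup[OF assms(2)]])
    show "conjug a b \<in> gen J" if "a \<in> i" "b \<in> gen J" for a b
      using gen_N_normal[OF assms(2)] that factor_subset_N[OF assms(1)] by blast
  qed
  note sm = set_mult_subgroup_subset[OF factor_subgroup[OF assms(1)] gen_subgroup[OF assms(2)]]
  have "j \<subseteq> i <#> gen J" if "j \<in> J" for j
    using factor_subset_gen[OF that] sm(2) by (rule subset_trans)
  then have "\<Union>(insert i J) \<subseteq> i <#> gen J"
    using sm(1) by (simp add: Sup_le_iff)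
  then have "gen (insert i J) \<subseteq> i <#> gen J"
    unfolding gen_def[of "insert i J"] by (rule generate_subgroup_incl[OF _ sub])
  then show ?thesis using that assms(3) unfolding set_mult_def by blast
qed

lemma N_decompose:
  assumes "i \<in> factors" "n \<in> N"
  obtains a b where "a \<in> i" "b \<in> gen (factors - {i})" "n = a \<otimes> b"
  using gen_insert[OF assms(1), of "factors - {i}" n] assms that
  by (auto simp: insert_absorb gen_factors)

lemma central_trivial:
  assumes x: "x \<in> carrier G" "\<And>i a. i \<in> factors \<Longrightarrow> a \<in> i \<Longrightarrow> conjug a x = x"
  shows "x = \<one>"
proof (rule centralizer_trivial[OF N_subgroup N_nontrivial N_normal x(1)])
  fix n assume n: "n \<in> N"
  then have "n \<in> generate G (\<Union>factors)" using gen_factors by (simp add: gen_def)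
  then have "conjug n x = x"
    using commute_generate[OF Union_carrier[OF subset_refl] x(1)] x(2) by blast
  then show "conjug x n = n"
    using conjug_fixed_iff[of n x] conjug_fixed_iff[of x n] N_carrier[OF n] x(1) by force
qed simp_all

text \<open>Every factor lies outside \<open>J\<close> or outside \<open>J'\<close> and so commutes
  with \<open>x\<close>, seen as an element of the corresponding product. Hence \<open>x\<close>
  centralises \<open>N\<close>; this makes the product of the factors direct.\<close>

lemma gen_disjoint:
  assumes J: "J \<subseteq> factors" "J' \<subseteq> factors" "J \<inter> J' = {}" and x: "x \<in> gen J" "x \<in> gen J'"
  shows "x = \<one>"
proof (rule central_trivial)
  show "x \<in> carrier G" using gen_carrier J x by blast
  fix i a assume i: "i \<in> factors" "a \<in> i"
  then have a: "a \<in> gen {i}" using factor_subset_gen by blast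
  show "conjug a x = x"
  proof (cases "i \<in> J")
    case True
    then show ?thesis using gen_commute[OF _ J(2) _ a x(2)] i J by blast
  next
    case False
    then show ?thesis using gen_commute[OF _ J(1) _ a x(1)] i J by blast
  qed
qed

section \<open>The subgroups \<open>Q i\<close> between \<open>S\<close> and
  \<open>N\<close>\<close>

definition S :: "'a set" where
  "S = N \<inter> stab w"

text \<open>The setwise stabiliser in \<open>N\<close> of the orbit of \<open>w\<close> under
  \<open>gen (factors - {i})\<close>; \<open>Q_T_iff\<close> is the case of
  \<open>T\<close>.\<close>

definition Q :: "'a set \<Rightarrow> 'a set" where
  "Q i = S <#> gen (factors - {i})"

lemma S_subgroup: "subgroup S G"
  unfolding S_def by (rule subgroups_Inter_pair[OF N_subgroup stab_subgroup[OF w]])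

lemma S_iff: "n \<in> S \<longleftrightarrow> n \<in> N \<and> \<phi> n w = w"
  using N_carrier by (auto simp: S_def stab_iff)

lemma S_conjug: "h \<in> stab w \<Longrightarrow> s \<in> S \<Longrightarrow> conjug h s \<in> S"
  using N_normal[of h s] conjug_mem_subgroup[OF stab_subgroup[OF w], of h s]
  by (simp add: S_def stab_iff)

text \<open>Maximality of the stabiliser passes to \<open>N\<close> by the Dedekind law: if
  \<open>G\<close> is the product of the stabiliser and \<open>Y\<close>, an element of
  \<open>N\<close> has its stabiliser part in \<open>S\<close>, hence in \<open>Y\<close>.\<close>

lemma between:
  assumes Y: "subgroup Y G" "S \<subseteq> Y" "Y \<subseteq> N" "\<And>h x. h \<in> stab w \<Longrightarrow> x \<in> Y \<Longrightarrow> conjug h x \<in> Y"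
  shows "Y = S \<or> Y = N"
proof (cases "Y \<subseteq> stab w")
  case True
  then show ?thesis using Y(2,3) by (auto simp: S_def)
next
  case False
  then have G: "stab w <#> Y = carrier G" using invariant_subgroup_cases[OF w Y(1,4)] by blast
  have "n \<in> Y" if n: "n \<in> N" for n
  proof -
    have "n \<in> stab w <#> Y" using G N_carrier[OF n] by simp
    then obtain h x where hx: "h \<in> stab w" "x \<in> Y" "n = h \<otimes> x" unfolding set_mult_def by blast
    have c: "h \<in> carrier G" "x \<in> carrier G"
      using hx subgroup.mem_carrier[OF Y(1)] by (auto simp: stab_iff)
    have "h = n \<otimes> inv x" using c hx(3) by (simp add: m_assoc)
    then have "h \<in> N"
      using n hx(2) Y(3) subgroup.m_closed[OF N_subgroup] subgroup.m_inv_closed[OF N_subgroup] by blast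
    then have "h \<in> Y" using hx(1) Y(2) by (auto simp: S_def)
    then show ?thesis using hx subgroup.m_closed[OF Y(1)] by blast
  qed
  then show ?thesis using Y(3) by blast
qed

lemma S_gen_subgroup: "J \<subseteq> factors \<Longrightarrow> subgroup (S <#> gen J) G"
  by (rule subgroup_set_mult[OF S_subgroup gen_subgroup]) (auto simp: S_def intro: gen_N_normal)

lemma S_gen_subset_N:
  assumes "J \<subseteq> factors"
  shows "S <#> gen J \<subseteq> N"
proof
  fix x assume "x \<in> S <#> gen J"
  then obtain s a where "s \<in> S" "a \<in> gen J" "x = s \<otimes> a" unfolding set_mult_def by blast
  then show "x \<in> N"
    using gen_subset_N[OF assms] subgroup.m_closed[OF N_subgroup] by (auto simp: S_def)
qed

lemma Q_subgroup: "subgroup (Q i) G"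
  unfolding Q_def by (rule S_gen_subgroup) blast

lemma Q_subset_N: "Q i \<subseteq> N"
  unfolding Q_def by (rule S_gen_subset_N) blast

lemma S_subset_Q: "S \<subseteq> Q i"
  unfolding Q_def by (rule set_mult_subgroup_subset(1)[OF S_subgroup gen_subgroup]) blast

lemma gen_subset_Q: "gen (factors - {i}) \<subseteq> Q i"
  unfolding Q_def by (rule set_mult_subgroup_subset(2)[OF S_subgroup gen_subgroup]) blast

lemma factor_subset_Q: "i \<in> factors \<Longrightarrow> i \<noteq> j \<Longrightarrow> i \<subseteq> Q j"
  using gen_subset_Q factor_subset_gen[of i "factors - {j}"] by blast

lemma Q_conjug:
  assumes h: "h \<in> stab w" and i: "i \<in> factors"
  shows "conjug h ` Q i = Q (conjug h ` i)"
proof -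
  have hc: "h \<in> carrier G" using h by (simp add: stab_iff)
  have "conjug h ` S = S"
    by (rule conjug_image_eqI[OF stab_subgroup[OF w] subgroup.subset[OF S_subgroup] S_conjug h])
  then show ?thesis
    unfolding Q_def
    by (simp add: conjug_image_set_mult[OF hc subgroup.subset[OF S_subgroup] subgroup.subset[OF gen_subgroup]]
        gen_complement_conjug[OF hc i])
qed

text \<open>The stabiliser of \<open>w\<close> permutes the \<open>Q i\<close>, so it preserves
  their intersection.\<close>

lemma Q_conjug_mem:
  assumes "h \<in> stab w" "x \<in> (\<Inter>i\<in>factors. Q i)"
  shows "conjug h x \<in> (\<Inter>i\<in>factors. Q i)"
proof
  fix i assume i: "i \<in> factors"
  have hc: "h \<in> carrier G" using assms(1) by (simp add: stab_iff)
  let ?j = "conjug (inv h) ` i"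
  have j: "?j \<in> factors" using factor_conjug[OF i] hc by simp
  have "conjug h ` ?j = i"
    using conjug_image_inv_cancel(2)[OF hc subgroup.subset[OF factor_subgroup[OF i]]] .
  then have "conjug h ` Q ?j = Q i" using Q_conjug[OF assms(1) j] by simp
  moreover have "x \<in> Q ?j" using assms(2) j by blast
  ultimately show "conjug h x \<in> Q i" by blast
qed

text \<open>Point stabilisers in the transitive group \<open>N\<close> are conjugate in
  \<open>N\<close>, so \<open>S\<close> trivial would make \<open>N\<close> regular.\<close>

lemma S_nontrivial: "S \<noteq> {\<one>}"
proof
  assume S1: "S = {\<one>}"
  have "n = \<one>" if n: "n \<in> N" and x: "x \<in> \<Omega>" "\<phi> n x = x" for n x
  proof -
    obtain m where m: "m \<in> N" "\<phi> m x = w" using N_transitive[OF x(1) w] by blast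
    have "\<phi> (conjug m n) w = w"
      using act_conjug[OF N_carrier[OF m(1)] N_carrier[OF n] x(1)] x(2) m(2) by simp
    then have "conjug m n = \<one>"
      using S1 S_iff N_normal[OF N_carrier[OF m(1)] n] by blast
    then show ?thesis using N_carrier m n by simp
  qed
  then show False using no_regular[OF N_subgroup] N_transitive by blast
qed

text \<open>A product of factors that is maximal subject to meeting \<open>S\<close> trivially is a
  complement to \<open>S\<close> in \<open>N\<close>, and therefore regular.\<close>

lemma not_all_Q:
  assumes all: "\<And>i. i \<in> factors \<Longrightarrow> Q i = N"
  shows False
proof -
  define P where "P J \<longleftrightarrow> J \<subseteq> factors \<and> gen J \<inter> S = {\<one>}" for J
  have "P {}"
    using subgroup.one_closed[OF S_subgroup] by (auto simp: P_def gen_def generate_empty)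
  then obtain J where J: "P J" and max: "\<And>J'. P J' \<Longrightarrow> J \<subseteq> J' \<Longrightarrow> J' = J"
    using finite_has_maximal[of "{J. P J}"] finite_subset[of "{J. P J}" "Pow factors"] finite_factors
    by (metis (no_types, lifting) P_def PowI empty_iff finite_Pow_iff mem_Collect_eq subsetI)
  have Jf: "J \<subseteq> factors" and J1: "gen J \<inter> S = {\<one>}" using J by (auto simp: P_def)
  have key: "i \<subseteq> S <#> gen J" if i: "i \<in> factors" "i \<notin> J" for i
  proof -
    let ?D = "factors - {i}"
    let ?X = "gen (insert i J) \<inter> S"
    have iJ: "insert i J \<subseteq> factors" using i Jf by blast
    have Xs: "subgroup ?X G" by (rule subgroups_Inter_pair[OF gen_subgroup[OF iJ] S_subgroup])
    have Ds: "subgroup (gen ?D) G" by (rule gen_subgroup) blast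
    have XN: "?X \<subseteq> N" by (auto simp: S_def)
    define B where "B = ?X <#> gen ?D"
    have Bs: "subgroup B G" unfolding B_def
    proof (rule subgroup_set_mult[OF Xs Ds])
      show "conjug a b \<in> gen ?D" if "a \<in> ?X" "b \<in> gen ?D" for a b
        by (rule gen_N_normal) (use that in \<open>auto simp: S_def\<close>)
    qed
    note Bsub = set_mult_subgroup_subset[OF Xs Ds, folded B_def]
    \<comment> \<open>\<open>B\<close> is normal in \<open>N\<close>: by hypothesis \<open>N\<close>
      is \<open>S\<close> times \<open>gen ?D\<close>; here \<open>gen ?D\<close> lies in
      \<open>B\<close>, while \<open>S\<close> normalises both parts of \<open>B\<close>.\<close>
    have Bn: "conjug n b \<in> B" if n: "n \<in> N" and b: "b \<in> B" for n b
    proof -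
      have "n \<in> S <#> gen ?D" using all[OF i(1)] n by (simp add: Q_def)
      then obtain s d where sd: "s \<in> S" "d \<in> gen ?D" "n = s \<otimes> d" unfolding set_mult_def by blast
      have c: "s \<in> carrier G" "d \<in> carrier G" "b \<in> carrier G"
        using sd subgroup.mem_carrier[OF S_subgroup] subgroup.mem_carrier[OF Ds]
          subgroup.mem_carrier[OF Bs] b by auto
      have "conjug d b \<in> B" using conjug_mem_subgroup[OF Bs] sd(2) Bsub(2) b by blast
      then obtain x e where xe: "x \<in> ?X" "e \<in> gen ?D" "conjug d b = x \<otimes> e"
        unfolding B_def set_mult_def by blast
      have c': "x \<in> carrier G" "e \<in> carrier G"
        using xe subgroup.mem_carrier[OF Xs] subgroup.mem_carrier[OF Ds] by auto
      have "conjug n b = conjug s x \<otimes> conjug s e"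
        using c c' sd(3) xe(3) by (simp add: conjug_mult_left conjug_mult)
      moreover have "conjug s x \<in> ?X"
        using gen_N_normal[OF iJ, of s x] conjug_mem_subgroup[OF S_subgroup sd(1)] xe(1) sd(1)
        by (simp add: S_def)
      moreover have "conjug s e \<in> gen ?D"
        by (rule gen_N_normal) (use sd xe in \<open>auto simp: S_def\<close>)
      ultimately show ?thesis unfolding B_def by (simp add: set_mult_memI)
    qed
    have iB: "i \<inter> B = {\<one>} \<or> i \<inter> B = i"
    proof (rule minimal_invariantD[OF factor_minimal[OF i(1)]])
      show "subgroup (i \<inter> B) G" by (rule subgroups_Inter_pair[OF factor_subgroup[OF i(1)] Bs])
      show "conjug g b \<in> i \<inter> B" if "g \<in> N" "b \<in> i \<inter> B" for g b
        using that Bn minimal_invariant_closed[OF factor_minimal[OF i(1)]] by blast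
    qed blast
    show ?thesis
    \<comment> \<open>If the normal subgroup \<open>B\<close> of \<open>N\<close> meets \<open>i\<close> trivially, then \<open>?X\<close> centralises \<open>i\<close> and so lies in
      \<open>gen J\<close>, which contradicts the maximality of \<open>J\<close>.\<close>
    proof (cases "i \<inter> B = {\<one>}")
      case True
      have "x = \<one>" if x: "x \<in> ?X" for x
      proof -
        obtain t u where tu: "t \<in> i" "u \<in> gen J" "x = t \<otimes> u" using gen_insert[OF i(1) Jf] x by blast
        have c: "t \<in> carrier G" "u \<in> carrier G"
          using tu subgroup.mem_carrier[OF factor_subgroup[OF i(1)]] gen_carrier[OF Jf] by auto
        have cx: "conjug a x = x" if a: "a \<in> i" for a
        proof -
          have c: "a \<in> carrier G" "x \<in> carrier G"
            using a x subgroup.mem_carrier[OF factor_subgroup[OF i(1)]] subgroup.mem_carrier[OF Xs]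
            by auto
          have xB: "x \<in> B" using x Bsub(1) by blast
          have aN: "a \<in> N" using a factor_subset_N[OF i(1)] by blast
          have xN: "x \<in> N" using x XN by blast
          have "conjug a x \<otimes> inv x \<in> B"
            using Bn[OF aN xB] xB subgroup.m_closed[OF Bs] subgroup.m_inv_closed[OF Bs] by blast
          moreover have "conjug a x \<otimes> inv x = a \<otimes> conjug x (inv a)"
            using c by (simp add: conjug_def m_assoc)
          moreover have "a \<otimes> conjug x (inv a) \<in> i"
            using a minimal_invariant_closed[OF factor_minimal[OF i(1)] xN, of "inv a"]
              subgroup.m_closed[OF factor_subgroup[OF i(1)]]
              subgroup.m_inv_closed[OF factor_subgroup[OF i(1)]] by blast
          ultimately have "conjug a x \<otimes> inv x = \<one>" using True by auto
          then show ?thesis using c by (metis conjug_closed inv_closed inv_equality inv_inv)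
        qed
        \<comment> \<open>The \<open>i\<close>-part \<open>t\<close> of \<open>x\<close> commutes
          with \<open>i\<close>, because \<open>x\<close> and \<open>u\<close> do, and with every
          other factor, because it lies in \<open>i\<close>.\<close>
        have "t = \<one>"
        proof (rule central_trivial[OF c(1)])
          fix j a assume j: "j \<in> factors" "a \<in> j"
          show "conjug a t = t"
          proof (cases "j = i")
            case True
            have ac: "a \<in> carrier G"
              using j True subgroup.mem_carrier[OF factor_subgroup[OF i(1)]] by blast
            have "conjug a u = u"
              by (rule gen_commute[of "{i}" J])
                (use i j True Jf tu factor_subset_gen[of i "{i}"] in auto)
            then have "conjug a t \<otimes> u = t \<otimes> u"
              using cx[of a] j True c ac tu(3) by (simp add: conjug_mult)
            then show ?thesis using c ac by simp
          next
            case False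
            then show ?thesis using factor_commute[OF j(1) i(1) False j(2) tu(1)] by simp
          qed
        qed
        then have "x \<in> gen J \<inter> S" using tu c x by simp
        then show ?thesis using J1 by blast
      qed
      then have "?X = {\<one>}" using subgroup.one_closed[OF Xs] by blast
      then have "P (insert i J)" using iJ by (simp add: P_def)
      then show ?thesis using max[of "insert i J"] i(2) by blast
    next
      case False
      then have iB: "i \<subseteq> B" using iB by blast
      show ?thesis
      proof
        fix t assume t: "t \<in> i"
        then have "t \<in> ?X <#> gen ?D" using iB by (auto simp: B_def)
        then obtain x y where xy: "x \<in> ?X" "y \<in> gen ?D" "t = x \<otimes> y" unfolding set_mult_def by blast
        obtain s u where su: "s \<in> i" "u \<in> gen J" "x = s \<otimes> u" using gen_insert[OF i(1) Jf] xy(1) by blast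
        have uD: "u \<in> gen ?D" using su(2) gen_mono[of J ?D] Jf i(2) by blast
        have c: "t \<in> carrier G" "s \<in> carrier G" "u \<in> carrier G" "y \<in> carrier G"
          using t su(1) uD xy(2) subgroup.mem_carrier[OF factor_subgroup[OF i(1)]]
            subgroup.mem_carrier[OF Ds] by auto
        \<comment> \<open>The left side lies in \<open>i\<close> and the right side in the product
          of the other factors, so both are trivial. Thus \<open>y\<close> is \<open>inv u\<close>,
          and only factors in \<open>J\<close> are needed to write \<open>t\<close>.\<close>
        have "inv s \<otimes> t = u \<otimes> y" using xy(3) su(3) c by (simp add: m_assoc)
        moreover have "inv s \<otimes> t \<in> i"
          using t su(1) subgroup.m_closed[OF factor_subgroup[OF i(1)]]
            subgroup.m_inv_closed[OF factor_subgroup[OF i(1)]] by blast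
        moreover have "u \<otimes> y \<in> gen ?D" using uD xy(2) subgroup.m_closed[OF Ds] by blast
        ultimately have "u \<otimes> y = \<one>"
          using gen_disjoint[of "{i}" ?D "u \<otimes> y"] factor_subset_gen[of i "{i}"] i(1) by auto
        then have "y = inv u" using c by (metis inv_equality inv_inv inv_closed)
        then have "t = x \<otimes> inv u" using xy(3) by simp
        moreover have "inv u \<in> gen J" using su(2) subgroup.m_inv_closed[OF gen_subgroup[OF Jf]] by blast
        ultimately show "t \<in> S <#> gen J" using xy(1) by (simp add: set_mult_memI)
      qed
    qed
  qed
  have SJ: "S <#> gen J = N"
  proof
    have "j \<subseteq> S <#> gen J" if "j \<in> factors" for j
    proof (cases "j \<in> J")
      case True
      then show ?thesis
        using factor_subset_gen[OF True] set_mult_subgroup_subset(2)[OF S_subgroup gen_subgroup[OF Jf]]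
        by blast
    qed (rule key[OF that])
    then have "gen factors \<subseteq> S <#> gen J"
      unfolding gen_def[of factors] by (intro generate_subgroup_incl[OF _ S_gen_subgroup[OF Jf]]) blast
    then show "N \<subseteq> S <#> gen J" by (simp add: gen_factors)
  qed (rule S_gen_subset_N[OF Jf])
  \<comment> \<open>In an element \<open>s \<otimes> r\<close> of \<open>N\<close> taking
    \<open>x\<close> to \<open>w\<close>, the part \<open>s\<close> fixes \<open>w\<close>, so
    \<open>r\<close> alone takes \<open>x\<close> to \<open>w\<close>.\<close>
  have toJ: "\<exists>r\<in>gen J. \<phi> r x = w" if x: "x \<in> \<Omega>" for x
  proof -
    obtain n where n: "n \<in> N" "\<phi> n x = w" using N_transitive[OF x w] by blast
    obtain s r where sr: "s \<in> S" "r \<in> gen J" "n = s \<otimes> r"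
      using n(1) SJ unfolding set_mult_def by blast
    have c: "s \<in> carrier G" "r \<in> carrier G"
      using sr subgroup.mem_carrier[OF S_subgroup] gen_carrier[OF Jf] by auto
    have "\<phi> s (\<phi> r x) = \<phi> s w" using n sr c x by (simp add: act_mult S_iff)
    then have "\<phi> r x = w"
      using inj_prop[OF c(1)] act_closed[OF c(2) x] w by (auto dest: inj_onD)
    then show ?thesis using sr(2) by blast
  qed
  show False
  proof (rule no_regular[OF gen_subgroup[OF Jf]]; intro ballI impI)
    fix x y assume xy: "x \<in> \<Omega>" "y \<in> \<Omega>"
    obtain r r' where r: "r \<in> gen J" "\<phi> r x = w" "r' \<in> gen J" "\<phi> r' y = w" using toJ xy by blast
    have c: "r \<in> carrier G" "r' \<in> carrier G" using r gen_carrier[OF Jf] by auto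
    have "\<phi> (inv r' \<otimes> r) x = y" using act_inv(1)[OF c(2) xy(2)] r c xy by (simp add: act_mult)
    moreover have "inv r' \<otimes> r \<in> gen J"
      using r subgroup.m_closed[OF gen_subgroup[OF Jf]] subgroup.m_inv_closed[OF gen_subgroup[OF Jf]] by blast
    ultimately show "\<exists>r\<in>gen J. \<phi> r x = y" by blast
  next
    fix r x assume r: "r \<in> gen J" and x: "x \<in> \<Omega>" and fx: "\<phi> r x = x"
    obtain q where q: "q \<in> gen J" "\<phi> q x = w" using toJ[OF x] by blast
    have c: "r \<in> carrier G" "q \<in> carrier G" using r q gen_carrier[OF Jf] by auto
    \<comment> \<open>A fixed point of \<open>r\<close> is moved to \<open>w\<close> inside
      \<open>gen J\<close>, which places a conjugate of \<open>r\<close> in the trivial group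
      \<open>gen J \<inter> S\<close>.\<close>
    have "\<phi> (conjug q r) w = w" using act_conjug[OF c(2,1) x] fx q(2) by simp
    moreover have "conjug q r \<in> gen J" by (rule conjug_mem_subgroup[OF gen_subgroup[OF Jf] q(1) r])
    ultimately have "conjug q r \<in> gen J \<inter> S" using gen_subset_N[OF Jf] by (auto simp: S_iff)
    then show "r = \<one>" using J1 c by auto
  qed
qed

text \<open>By \<open>between\<close>, the intersection is \<open>S\<close> or \<open>N\<close>, and
  \<open>N\<close> would force every \<open>Q i\<close> to be \<open>N\<close>.\<close>

lemma Inter_Q: "(\<Inter>i\<in>factors. Q i) = S"
proof -
  let ?X = "\<Inter>i\<in>factors. Q i"
  have "subgroup ?X G"
    by (rule subgroups_Inter) (use Q_subgroup T_factor in auto)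
  moreover have "S \<subseteq> ?X" using S_subset_Q by blast
  moreover have "?X \<subseteq> N" using Q_subset_N T_factor by blast
  ultimately have "?X = S \<or> ?X = N" by (rule between[OF _ _ _ Q_conjug_mem])
  moreover have "?X \<noteq> N" using not_all_Q Q_subset_N by blast
  ultimately show ?thesis by blast
qed

text \<open>Elements normalising all \<^term>\<open>Q i\<close> form a subgroup between \<^term>\<open>S\<close> and \<^term>\<open>N\<close>. It is not
  \<^term>\<open>N\<close>, since otherwise \<^term>\<open>S\<close> would be normal in \<^term>\<open>N\<close> and \<^term>\<open>N\<close> would be regular.\<close>

lemma normalizes_Q:
  assumes n: "n \<in> N" and norm: "\<And>i. i \<in> factors \<Longrightarrow> conjug n ` Q i = Q i"
  shows "n \<in> S"
proof -
  define Y where "Y = {n \<in> N. \<forall>i\<in>factors. conjug n ` Q i = Q i}"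
  have Qc: "Q i \<subseteq> carrier G" for i by (rule subgroup.subset[OF Q_subgroup])
  have Xs: "subgroup Y G"
  proof (rule subgroupI)
    show "Y \<subseteq> carrier G" using N_carrier by (auto simp: Y_def)
    have "\<one> \<in> Y"
      using subgroup.one_closed[OF N_subgroup] conjug_image_by_one[OF Qc] by (simp add: Y_def)
    then show "Y \<noteq> {}" by blast
    show "inv a \<in> Y" if a: "a \<in> Y" for a
    proof -
      have "conjug (inv a) ` Q i = Q i" if "i \<in> factors" for i
        using conjug_image_inv_cancel(1)[OF N_carrier Qc[of i], of a] a that by (simp add: Y_def)
      then show ?thesis using a subgroup.m_inv_closed[OF N_subgroup] by (simp add: Y_def)
    qed
    show "a \<otimes> b \<in> Y" if ab: "a \<in> Y" "b \<in> Y" for a b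
    proof -
      have "conjug (a \<otimes> b) ` Q i = Q i" if "i \<in> factors" for i
        using conjug_image_mult_left[OF N_carrier N_carrier Qc[of i], of a b] ab that by (simp add: Y_def)
      then show ?thesis using ab subgroup.m_closed[OF N_subgroup] by (simp add: Y_def)
    qed
  qed
  have SX: "S \<subseteq> Y"
  proof
    fix s assume s: "s \<in> S"
    have "conjug s ` Q i = Q i" for i
      using conjug_image_subgroup[OF Q_subgroup] s S_subset_Q by blast
    then show "s \<in> Y" using s by (simp add: Y_def S_def)
  qed
  have "conjug h x \<in> Y" if h: "h \<in> stab w" and x: "x \<in> Y" for h x
  proof -
    have hc: "h \<in> carrier G" using h by (simp add: stab_iff)
    have hi: "inv h \<in> stab w" using subgroup.m_inv_closed[OF stab_subgroup[OF w] h] .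
    have xc: "x \<in> carrier G" using x N_carrier by (simp add: Y_def)
    have "conjug (conjug h x) ` Q i = Q i" if i: "i \<in> factors" for i
    proof -
      let ?j = "conjug (inv h) ` i"
      have j: "?j \<in> factors" using factor_conjug[OF i] hc by simp
      have "conjug h x = h \<otimes> (x \<otimes> inv h)" using hc xc by (simp add: conjug_def m_assoc)
      \<comment> \<open>In three stages: \<open>inv h\<close> sends \<open>Q i\<close> to
        \<open>Q ?j\<close>, \<open>x\<close> preserves that, and \<open>h\<close> returns it to
        \<open>Q i\<close>.\<close>
      then have "conjug (conjug h x) ` Q i = conjug h ` conjug x ` conjug (inv h) ` Q i"
        using hc xc Qc by (simp add: conjug_image_mult_left conjug_image_closed)
      also have "conjug (inv h) ` Q i = Q ?j" by (rule Q_conjug[OF hi i])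
      also have "conjug x ` Q ?j = Q ?j" using x j by (simp add: Y_def)
      also have "Q ?j = conjug (inv h) ` Q i" by (rule Q_conjug[OF hi i, symmetric])
      finally show ?thesis using conjug_image_inv_cancel(2)[OF hc Qc] by simp
    qed
    then show ?thesis using x N_normal[OF hc] by (simp add: Y_def)
  qed
  moreover have "Y \<subseteq> N" by (auto simp: Y_def)
  ultimately have "Y = S \<or> Y = N" using between[OF Xs SX] by blast
  moreover have "Y \<noteq> N"
  proof
    assume XN: "Y = N"
    \<comment> \<open>\<open>N\<close> preserves each \<open>Q i\<close>, hence their intersection,
      which is \<open>S\<close>.\<close>
    have Sn: "conjug m s \<in> S" if m: "m \<in> N" and s: "s \<in> S" for m s
    proof -
      have "conjug m s \<in> Q i" if i: "i \<in> factors" for i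
      proof -
        have "conjug m ` Q i = Q i" using m i XN by (auto simp: Y_def)
        then show ?thesis using s S_subset_Q[of i] by blast
      qed
      then show ?thesis using Inter_Q by blast
    qed
    \<comment> \<open>A normal point stabiliser of the transitive group \<open>N\<close> fixes all
      points.\<close>
    have "s = \<one>" if s: "s \<in> S" for s
    proof (rule act_eq_one)
      show sc: "s \<in> carrier G" using s subgroup.mem_carrier[OF S_subgroup] by blast
      fix x assume x: "x \<in> \<Omega>"
      obtain m where m: "m \<in> N" "\<phi> m x = w" using N_transitive[OF x w] by blast
      have mc: "m \<in> carrier G" by (rule N_carrier[OF m(1)])
      have "\<phi> m (\<phi> s x) = \<phi> (conjug m s) w"
        using act_conjug[OF mc sc x] m(2) by simp
      also have "\<dots> = \<phi> m x" using Sn[OF m(1) s] m(2) by (simp add: S_iff)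
      finally show "\<phi> s x = x"
        using inj_prop[OF mc] act_closed[OF sc x] x by (auto dest: inj_onD)
    qed
    then show False using S_nontrivial subgroup.one_closed[OF S_subgroup] by blast
  qed
  ultimately show ?thesis using n norm by (auto simp: Y_def)
qed

end

section \<open>Recognising almost simple groups\<close>

text \<open>Conjugation maps \<open>G\<close> to the automorphisms of \<open>T\<close>, injectively
  because the centraliser of \<open>T\<close> is trivial. Being minimal under its own conjugation,
  \<open>T\<close> is simple, and it becomes \<open>Inn T\<close> in the image.\<close>

lemma almost_simpleI:
  fixes G :: "'a monoid" (structure)
  assumes G: "group G"
    and T: "group.minimal_invariant G T T" "finite T"
    and normal: "\<And>g t. g \<in> carrier G \<Longrightarrow> t \<in> T \<Longrightarrow> group.conjug G g t \<in> T"
    and central: "\<And>c. c \<in> carrier G \<Longrightarrow> (\<And>t. t \<in> T \<Longrightarrow> group.conjug G c t = t) \<Longrightarrow> c = \<one>"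
  shows "almost_simple G"
proof -
  interpret group G by (rule G)
  let ?T = "G\<lparr>carrier := T\<rparr>"
  note Ts = minimal_invariant_subgroup[OF T(1)]
  note Tc = subgroup.mem_carrier[OF Ts]
  interpret T: group ?T by (rule subgroup.subgroup_is_group[OF Ts group_axioms])
  have ntriv: "\<exists>t\<in>T. t \<noteq> \<one>"
    using minimal_invariant_nontrivial[OF T(1)] subgroup.one_closed[OF Ts] by blast
  have simple: "simple_group ?T"
  proof
    have "card {\<one>} < card T"
      using T(2) ntriv subgroup.one_closed[OF Ts] by (intro psubset_card_mono) auto
    then show "1 < order ?T" by (simp add: order_def)
    fix H assume H: "H \<lhd> ?T"
    then have Hs: "subgroup H ?T" by (simp add: normal_def)
    have "H = {\<one>} \<or> H = T"
    proof (rule minimal_invariantD[OF T(1)])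
      show "subgroup H G" by (rule incl_subgroup[OF Ts Hs])
      show "H \<subseteq> T" using subgroup.subset[OF Hs] by simp
      show "conjug t h \<in> H" if "t \<in> T" "h \<in> H" for t h
        using normal.inv_op_closed2[OF H, of t h] that m_inv_consistent[OF Ts]
        by (simp add: conjug_def)
    qed
    then show "H = carrier ?T \<or> H = {\<one>\<^bsub>?T\<^esub>}" by auto
  qed
  \<comment> \<open>An abelian \<open>T\<close> would centralise itself and so be trivial.\<close>
  have noncomm: "\<not> comm_group ?T"
  proof
    assume "comm_group ?T"
    then have comm: "s \<otimes> t = t \<otimes> s" if "s \<in> T" "t \<in> T" for s t
      using comm_monoid.m_comm[of ?T s t] that by (simp add: comm_group_def)
    have "s = \<one>" if s: "s \<in> T" for s
      by (rule central[OF Tc[OF s]]) (use s Tc comm conjug_fixed_iff in blast)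
    then show False using ntriv by blast
  qed
  define c where "c g = (\<lambda>t\<in>T. conjug g t)" for g
  interpret Aut: group "AutoGroup ?T" by (rule T.AutoGroup)
  have inj: "inj_on c (carrier G)"
  proof (rule inj_onI)
    fix g h assume gh: "g \<in> carrier G" "h \<in> carrier G" "c g = c h"
    have "conjug (inv h \<otimes> g) t = t" if t: "t \<in> T" for t
      using fun_cong[OF gh(3), of t] gh Tc[OF t] t by (simp add: c_def conjug_mult_left)
    then have "inv h \<otimes> g = \<one>" using gh by (intro central) auto
    then show "g = h" using gh by (metis inv_closed inv_equality inv_inv)
  qed
  have Bij: "c g \<in> Bij T" if g: "g \<in> carrier G" for g
  proof -
    have "bij_betw (c g) T T"
      by (rule bij_betw_byWitness[where f' = "conjug (inv g)"])
        (use g normal Tc in \<open>auto simp: c_def\<close>)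
    then show ?thesis by (simp add: Bij_def c_def)
  qed
  have auto_c: "c g \<in> carrier (AutoGroup ?T)" if g: "g \<in> carrier G" for g
    using Bij[OF g] g normal Tc subgroup.m_closed[OF Ts]
    by (auto simp: AutoGroup_def auto_def hom_def c_def conjug_mult)
  have mult_c: "c (g \<otimes> h) = c g \<otimes>\<^bsub>AutoGroup ?T\<^esub> c h" if "g \<in> carrier G" "h \<in> carrier G" for g h
    using that Bij normal Tc
    by (auto simp: AutoGroup_def BijGroup_def compose_def c_def conjug_mult_left restrict_def)
  interpret c: group_hom G "AutoGroup ?T" c
    by unfold_locales (auto simp: hom_def auto_c mult_c)
  let ?A = "c ` carrier G"
  let ?L = "(AutoGroup ?T)\<lparr>carrier := ?A\<rparr>"
  have A: "subgroup ?A (AutoGroup ?T)" by (rule c.img_is_subgroup)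
  interpret L: group ?L by (rule subgroup.subgroup_is_group[OF A Aut.group_axioms])
  \<comment> \<open>Normality of \<open>Inn ?T\<close> in the image thereby becomes invariance of
    \<open>T\<close> under \<open>G\<close>.\<close>
  have Inn: "Inn ?T = c ` T"
    by (auto simp: Inn_def c_def conjug_def m_inv_consistent[OF Ts] cong: image_cong)
  have "Inn ?T \<lhd> ?L"
    unfolding L.normal_inv_iff Inn
  proof (intro conjI ballI)
    have "subgroup (c ` T) (AutoGroup ?T)" by (rule c.subgroup_img_is_subgroup[OF Ts])
    then show "subgroup (c ` T) ?L"
      using A Tc by (intro Aut.subgroup_incl) auto
    fix x h assume "x \<in> carrier ?L" "h \<in> c ` T"
    then obtain g t where gt: "g \<in> carrier G" "t \<in> T" "x = c g" "h = c t" by auto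
    have "x \<otimes>\<^bsub>?L\<^esub> h \<otimes>\<^bsub>?L\<^esub> inv\<^bsub>?L\<^esub> x = c (conjug g t)"
      using gt Tc Aut.m_inv_consistent[OF A, of "c g"] by (simp add: conjug_def flip: c.hom_inv)
    then show "x \<otimes>\<^bsub>?L\<^esub> h \<otimes>\<^bsub>?L\<^esub> inv\<^bsub>?L\<^esub> x \<in> c ` T"
      using normal[OF gt(1,2)] by simp
  qed
  moreover have "c \<in> iso G ?L"
    using inj mult_c by (auto simp: iso_def hom_def bij_betw_def)
  then have "G \<cong> ?L" unfolding is_iso_def by blast
  ultimately show ?thesis
    unfolding almost_simple_def using group_axioms simple noncomm A by blast
qed

section \<open>Blocks and coordinates\<close>

context minimal_normal
begin

section \<open>Blocks of the complements\<close>

definition same_block :: "'a set \<Rightarrow> 'c \<Rightarrow> 'c \<Rightarrow> bool" where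
  "same_block i x y \<longleftrightarrow> (\<exists>a\<in>gen (factors - {i}). \<phi> a x = y)"

lemma complement_subgroup: "subgroup (gen (factors - {i})) G"
  by (rule gen_subgroup) blast

lemma complement_carrier: "a \<in> gen (factors - {i}) \<Longrightarrow> a \<in> carrier G"
  by (rule subgroup.mem_carrier[OF complement_subgroup])

lemma same_block_refl: "x \<in> \<Omega> \<Longrightarrow> same_block i x x"
  using subgroup.one_closed[OF complement_subgroup] act_one by (auto simp: same_block_def)

lemma same_block_sym:
  assumes "x \<in> \<Omega>" "same_block i x y"
  shows "same_block i y x"
proof -
  obtain a where a: "a \<in> gen (factors - {i})" "\<phi> a x = y" using assms by (auto simp: same_block_def)
  then have "\<phi> (inv a) y = x" using act_inv(1)[OF complement_carrier assms(1)] by blast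
  then show ?thesis using subgroup.m_inv_closed[OF complement_subgroup a(1)] by (auto simp: same_block_def)
qed

lemma same_block_trans:
  assumes "x \<in> \<Omega>" "same_block i x y" "same_block i y z"
  shows "same_block i x z"
proof -
  obtain a b where ab: "a \<in> gen (factors - {i})" "\<phi> a x = y" "b \<in> gen (factors - {i})" "\<phi> b y = z"
    using assms by (auto simp: same_block_def)
  then have "\<phi> (b \<otimes> a) x = z" using act_mult[OF complement_carrier complement_carrier assms(1)] by blast
  then show ?thesis using subgroup.m_closed[OF complement_subgroup ab(3,1)] by (auto simp: same_block_def)
qed

lemma same_block_act:
  assumes "g \<in> carrier G" "i \<in> factors" "x \<in> \<Omega>" "same_block i x y"
  shows "same_block (conjug g ` i) (\<phi> g x) (\<phi> g y)"
proof -
  obtain a where a: "a \<in> gen (factors - {i})" "\<phi> a x = y" using assms by (auto simp: same_block_def)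
  have "conjug g a \<in> gen (factors - {conjug g ` i})"
    using imageI[OF a(1), of "conjug g"] gen_complement_conjug[OF assms(1,2)] by simp
  moreover have "\<phi> (conjug g a) (\<phi> g x) = \<phi> g y"
    using act_conjug[OF assms(1) complement_carrier[OF a(1)] assms(3)] a(2) by simp
  ultimately show ?thesis by (auto simp: same_block_def)
qed

text \<open>For \<open>x\<close> and \<open>y\<close> the images of \<open>w\<close> under
  \<open>n\<close> and \<open>m\<close>, a common \<open>i\<close>-block means that
  \<open>inv m \<otimes> n\<close> lies in \<open>Q i\<close>. The intersection of the
  \<open>Q i\<close> is \<open>S\<close>, which fixes \<open>w\<close>.\<close>

lemma same_block_eqI:
  assumes x: "x \<in> \<Omega>" and y: "y \<in> \<Omega>" and same: "\<And>i. i \<in> factors \<Longrightarrow> same_block i x y"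
  shows "x = y"
proof -
  obtain n m where n: "n \<in> N" "\<phi> n w = x" and m: "m \<in> N" "\<phi> m w = y"
    using N_transitive[OF w] x y by blast
  have c: "n \<in> carrier G" "m \<in> carrier G" using N_carrier n m by blast+
  have NI: "inv m \<otimes> n \<in> N" "inv n \<in> N"
    using n m subgroup.m_closed[OF N_subgroup] subgroup.m_inv_closed[OF N_subgroup] by blast+
  have "inv m \<otimes> n \<in> Q i" if i: "i \<in> factors" for i
  proof -
    obtain a where a: "a \<in> gen (factors - {i})" "\<phi> a x = y"
      using same[OF i] by (auto simp: same_block_def)
    have ac: "a \<in> carrier G" by (rule complement_carrier[OF a(1)])
    \<comment> \<open>Chosen so that \<open>n \<otimes> ?b = a \<otimes> n\<close>: then
      \<open>inv m \<otimes> n \<otimes> ?b\<close> takes \<open>w\<close> via \<open>x\<close> and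
      \<open>y\<close> back to \<open>w\<close>.\<close>
    let ?b = "conjug (inv n) a"
    have b: "?b \<in> gen (factors - {i})" by (rule gen_N_normal[OF _ NI(2) a(1)]) blast
    have "inv m \<otimes> n \<otimes> ?b = inv m \<otimes> (a \<otimes> n)" using c ac by (simp add: conjug_def m_assoc)
    then have "\<phi> (inv m \<otimes> n \<otimes> ?b) w = w"
      using c ac n m a act_inv(1)[OF c(2) w] by (simp add: act_mult w act_closed)
    moreover have "inv m \<otimes> n \<otimes> ?b \<in> N"
      using NI(1) b gen_subset_N[of "factors - {i}"] subgroup.m_closed[OF N_subgroup] by blast
    ultimately have s: "inv m \<otimes> n \<otimes> ?b \<in> S" by (simp add: S_iff)
    have "inv m \<otimes> n = inv m \<otimes> n \<otimes> ?b \<otimes> inv ?b" using c ac by (simp add: m_assoc)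
    moreover have "inv m \<otimes> n \<otimes> ?b \<otimes> inv ?b \<in> Q i"
      unfolding Q_def using s subgroup.m_inv_closed[OF complement_subgroup b] by (rule set_mult_memI)
    ultimately show ?thesis by simp
  qed
  then have "inv m \<otimes> n \<in> S" using Inter_Q by blast
  then have "\<phi> m (\<phi> (inv m \<otimes> n) w) = \<phi> m w" by (simp add: S_iff)
  then show ?thesis using n m c act_inv(2)[OF c(2) x] by (simp add: act_mult w)
qed

text \<open>A Chinese remainder argument: blocks for different factors can be prescribed
  independently, since moving by a factor \<open>i\<close> changes only the
  \<open>i\<close>-block.\<close>

lemma same_block_solve:
  assumes "finite J" "J \<subseteq> factors" "\<And>i. i \<in> factors \<Longrightarrow> z i \<in> \<Omega>"
  shows "\<exists>x\<in>\<Omega>. \<forall>i\<in>J. same_block i (z i) x"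
  using assms(1,2)
proof (induction J)
  case empty
  then show ?case using w by blast
next
  case (insert i J)
  then obtain x where x: "x \<in> \<Omega>" "\<And>j. j \<in> J \<Longrightarrow> same_block j (z j) x" by blast
  have i: "i \<in> factors" using insert.prems by blast
  obtain n where n: "n \<in> N" "\<phi> n (z i) = x" using N_transitive[OF assms(3)[OF i] x(1)] by blast
  \<comment> \<open>Stopping halfway between \<open>z i\<close> and \<open>x\<close>, after
    \<open>a\<close> but before \<open>t\<close>, stays in the \<open>i\<close>-block of
    \<open>z i\<close> and agrees with \<open>x\<close> in all other blocks.\<close>
  obtain t a where ta: "t \<in> i" "a \<in> gen (factors - {i})" "n = t \<otimes> a" by (rule N_decompose[OF i n(1)])
  have c: "t \<in> carrier G" "a \<in> carrier G"
    using subgroup.mem_carrier[OF factor_subgroup[OF i] ta(1)] complement_carrier[OF ta(2)] .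
  let ?y = "\<phi> a (z i)"
  have y: "?y \<in> \<Omega>" using act_closed[OF c(2) assms(3)[OF i]] .
  have xy: "\<phi> t ?y = x" using n ta(3) c assms(3)[OF i] by (simp add: act_mult)
  have "same_block j (z j) ?y" if j: "j \<in> insert i J" for j
  proof (cases "j = i")
    case True
    then show ?thesis using ta(2) by (auto simp: same_block_def)
  next
    case False
    then have "t \<in> gen (factors - {j})" using factor_subset_gen[of i "factors - {j}"] i ta(1) by blast
    then have "same_block j ?y x" using xy by (auto simp: same_block_def)
    then have "same_block j x ?y" by (rule same_block_sym[OF y])
    moreover have "z j \<in> \<Omega>" using assms(3) insert.prems j by blast
    ultimately show ?thesis using same_block_trans x(2) j False by blast
  qed
  then show ?case using y by blast
qed

text \<open>A transversal of the blocks attached to \<^term>\<open>T\<close> serves as the alphabet of the product action, so that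
  the alphabet lies in the type of the points.\<close>

definition coord :: "'c \<Rightarrow> 'c" where
  "coord x = (SOME y. y \<in> \<Omega> \<and> same_block T x y)"

lemma coord:
  assumes "x \<in> \<Omega>"
  shows "coord x \<in> \<Omega>" "same_block T x (coord x)"
  using someI[of "\<lambda>y. y \<in> \<Omega> \<and> same_block T x y" x] same_block_refl[OF assms] assms
  by (auto simp: coord_def)

text \<open>Points of one block give the same predicate under \<open>SOME\<close>, so the choice
  depends on the block only.\<close>

lemma coord_eq_iff:
  assumes "x \<in> \<Omega>" "y \<in> \<Omega>"
  shows "coord x = coord y \<longleftrightarrow> same_block T x y"
proof
  assume "coord x = coord y"
  then have "same_block T y (coord x)" using coord(2)[OF assms(2)] by simp
  then show "same_block T x y"
    using same_block_trans[OF assms(1) coord(2)[OF assms(1)]] same_block_sym[OF assms(2)] by blast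
next
  assume xy: "same_block T x y"
  have "same_block T x z = same_block T y z" for z
    using same_block_trans[OF assms(2) same_block_sym[OF assms(1) xy]] same_block_trans[OF assms(1) xy]
    by blast
  then show "coord x = coord y" by (simp add: coord_def)
qed

section \<open>Action of the normaliser of \<open>T\<close> on the blocks\<close>

definition normT :: "'a set" where
  "normT = {g \<in> carrier G. conjug g ` T = T}"

lemma T_subset_carrier: "T \<subseteq> carrier G"
  by (rule subgroup.subset[OF T_subgroup])

lemma normT_carrier: "g \<in> normT \<Longrightarrow> g \<in> carrier G"
  by (simp add: normT_def)

lemma normT_subgroup: "subgroup normT G"
proof (rule subgroupI)
  have "\<one> \<in> normT" using conjug_image_by_one[OF T_subset_carrier] by (simp add: normT_def)
  then show "normT \<noteq> {}" by blast
  show "inv a \<in> normT" if "a \<in> normT" for a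
    using that conjug_image_inv_cancel(1)[OF _ T_subset_carrier, of a] by (simp add: normT_def)
  show "a \<otimes> b \<in> normT" if "a \<in> normT" "b \<in> normT" for a b
    using that conjug_image_mult_left[OF _ _ T_subset_carrier, of a b] by (simp add: normT_def)
qed (auto simp: normT_def)

lemma T_subset_normT: "T \<subseteq> normT"
  using conjug_image_subgroup[OF T_subgroup] T_subset_carrier by (auto simp: normT_def)

lemma coord_act:
  assumes "g \<in> normT" "x \<in> \<Omega>" "y \<in> \<Omega>" "coord x = coord y"
  shows "coord (\<phi> g x) = coord (\<phi> g y)"
proof -
  have g: "g \<in> carrier G" "conjug g ` T = T" using assms(1) by (simp_all add: normT_def)
  have "same_block T (\<phi> g x) (\<phi> g y)"
    using same_block_act[OF g(1) T_factor assms(2)] g(2) coord_eq_iff[OF assms(2,3)] assms(4) by simp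
  then show ?thesis using coord_eq_iff act_closed[OF g(1)] assms(2,3) by simp
qed

lemma coord_coord: "x \<in> \<Omega> \<Longrightarrow> coord (coord x) = coord x"
  using coord_eq_iff[OF _ coord(1)] coord(2) by metis

text \<open>\<open>N\<close> is transitive on points, and the part of its elements outside
  \<open>T\<close> does not change the block.\<close>

lemma coord_T_transitive:
  assumes "x \<in> \<Omega>" "y \<in> \<Omega>"
  shows "\<exists>t\<in>T. coord (\<phi> t x) = coord y"
proof -
  obtain n where n: "n \<in> N" "\<phi> n x = y" using N_transitive[OF assms] by blast
  obtain t a where ta: "t \<in> T" "a \<in> gen (factors - {T})" "n = t \<otimes> a"
    by (rule N_decompose[OF T_factor n(1)])
  have c: "t \<in> carrier G" "a \<in> carrier G"
    using T_subset_carrier ta(1) complement_carrier[OF ta(2)] by auto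
  have "same_block T x (\<phi> a x)" using ta(2) by (auto simp: same_block_def)
  then have "coord x = coord (\<phi> a x)" using coord_eq_iff act_closed c(2) assms(1) by blast
  then have "coord (\<phi> t x) = coord (\<phi> t (\<phi> a x))"
    using coord_act T_subset_normT ta(1) act_closed c(2) assms(1) by blast
  also have "\<phi> t (\<phi> a x) = y" using n ta(3) c assms by (simp add: act_mult)
  finally show ?thesis using ta(1) by blast
qed

text \<open>An element of \<open>T\<close> lies in the complement of every other factor, so it never
  changes the other blocks.\<close>

lemma T_coord_faithful:
  assumes t: "t \<in> T" and fixed: "\<And>x. x \<in> \<Omega> \<Longrightarrow> coord (\<phi> t x) = coord x"
  shows "t = \<one>"
proof (rule act_eq_one)
  show tc: "t \<in> carrier G" using t T_subset_carrier by blast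
  fix x assume x: "x \<in> \<Omega>"
  note tx = act_closed[OF tc x]
  have "same_block i x (\<phi> t x)" if i: "i \<in> factors" for i
  proof (cases "i = T")
    case True
    then show ?thesis using fixed[OF x] coord_eq_iff[OF x tx] by simp
  next
    case False
    then have "t \<in> gen (factors - {i})" using factor_subset_gen[of T "factors - {i}"] T_factor t by blast
    then show ?thesis by (auto simp: same_block_def)
  qed
  from same_block_eqI[OF x tx this] show "\<phi> t x = x" by simp
qed

lemma Q_T_iff:
  assumes n: "n \<in> N"
  shows "n \<in> Q T \<longleftrightarrow> coord (\<phi> n w) = coord w"
proof -
  have nc: "n \<in> carrier G" by (rule N_carrier[OF n])
  have nw: "\<phi> n w \<in> \<Omega>" by (rule act_closed[OF nc w])
  have "n \<in> Q T \<longleftrightarrow> same_block T w (\<phi> n w)"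
  proof
    assume "n \<in> Q T"
    then obtain s a where sa: "s \<in> S" "a \<in> gen (factors - {T})" "n = s \<otimes> a"
      unfolding Q_def set_mult_def by blast
    have sN: "s \<in> N" using sa(1) by (simp add: S_iff)
    have c: "s \<in> carrier G" "a \<in> carrier G" using N_carrier[OF sN] complement_carrier[OF sa(2)] .
    \<comment> \<open>Since \<open>s\<close> fixes \<open>w\<close>, it can be cancelled on the
      right, leaving an element of the complement that moves \<open>w\<close> to
      \<open>\<phi> n w\<close>.\<close>
    have "\<phi> (conjug s a) w = \<phi> n w"
      using act_conjug[OF c w] sa c by (simp add: S_iff act_mult w)
    moreover have "conjug s a \<in> gen (factors - {T})" by (rule gen_N_normal[OF _ sN sa(2)]) blast
    ultimately show "same_block T w (\<phi> n w)" by (auto simp: same_block_def)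
  next
    assume "same_block T w (\<phi> n w)"
    then obtain a where a: "a \<in> gen (factors - {T})" "\<phi> a w = \<phi> n w" by (auto simp: same_block_def)
    have ac: "a \<in> carrier G" by (rule complement_carrier[OF a(1)])
    have aN: "a \<in> N" using a(1) gen_subset_N[of "factors - {T}"] by blast
    have "\<phi> (inv a \<otimes> n) w = w" using a(2) act_inv(1)[OF ac w] ac nc by (simp add: act_mult w)
    moreover have "inv a \<otimes> n \<in> N"
      using n aN subgroup.m_closed[OF N_subgroup] subgroup.m_inv_closed[OF N_subgroup] by blast
    ultimately have "inv a \<otimes> n \<in> S" by (simp add: S_iff)
    then have "inv a \<otimes> n \<in> Q T" using S_subset_Q by blast
    moreover have "a \<in> Q T" using a(1) gen_subset_Q by blast
    ultimately have "a \<otimes> (inv a \<otimes> n) \<in> Q T" using subgroup.m_closed[OF Q_subgroup] by blast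
    then show "n \<in> Q T" using ac nc by simp
  qed
  then show ?thesis using coord_eq_iff[OF nw w] same_block_sym w nw by blast
qed

text \<open>The other factors centralise \<open>T\<close>, so a subgroup of \<open>T\<close>
  normalised by \<open>T\<close> is normalised by \<open>N\<close>.\<close>

lemma T_simple: "minimal_invariant T T"
  unfolding minimal_invariant_def
proof (intro conjI ballI allI impI)
  show "T \<noteq> {\<one>}" by (rule minimal_invariant_nontrivial[OF T(1)])
  show "conjug g ` T \<subseteq> T" if "g \<in> T" for g
    using conjug_image_subgroup[OF T_subgroup that] by simp
  fix B assume B: "subgroup B G" "B \<subseteq> T" "\<forall>g\<in>T. conjug g ` B \<subseteq> B"
  show "B = {\<one>} \<or> B = T"
  proof (rule minimal_invariantD[OF T(1) B(1,2)])
    fix n b assume n: "n \<in> N" and b: "b \<in> B"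
    obtain t a where ta: "t \<in> T" "a \<in> gen (factors - {T})" "n = t \<otimes> a"
      by (rule N_decompose[OF T_factor n])
    have c: "t \<in> carrier G" "a \<in> carrier G" "b \<in> carrier G"
      using T_subset_carrier ta(1) complement_carrier[OF ta(2)] b B(2) by auto
    have "b \<in> gen {T}" using b B(2) factor_subset_gen[of T "{T}"] by blast
    then have "conjug a b = b"
      using gen_commute[of "factors - {T}" "{T}" a b] ta(2) T_factor by blast
    then have "conjug n b = conjug t b" using ta(3) c by (simp add: conjug_mult_left)
    then show "conjug n b \<in> B" using B(3) ta(1) b by auto
  qed
qed (rule T_subgroup)

text \<open>Choose \<open>t \<in> T\<close> that moves \<^term>\<open>w\<close> to the block of \<open>c w\<close>. As \<open>c\<close> commutes with \<^term>\<open>T\<close> on blocks, \<open>t\<close>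
  normalises every \<^term>\<open>Q i\<close>. Hence it fixes \<^term>\<open>w\<close>, so \<open>c\<close> fixes the block of \<^term>\<open>w\<close> and,
  by transitivity of \<^term>\<open>T\<close>, every block.\<close>

lemma coord_centralizer_trivial:
  assumes c: "c \<in> normT"
    and comm: "\<And>t x. t \<in> T \<Longrightarrow> x \<in> \<Omega> \<Longrightarrow> coord (\<phi> c (\<phi> t x)) = coord (\<phi> t (\<phi> c x))"
    and x: "x \<in> \<Omega>"
  shows "coord (\<phi> c x) = coord x"
proof -
  have cc: "c \<in> carrier G" by (rule normT_carrier[OF c])
  note Tc = subsetD[OF T_subset_carrier] and Tn = subsetD[OF T_subset_normT]
  obtain t where t: "t \<in> T" "coord (\<phi> t w) = coord (\<phi> c w)"
    using coord_T_transitive[OF w act_closed[OF cc w]] by blast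
  have tc: "t \<in> carrier G" by (rule Tc[OF t(1)])
  have it: "inv t \<in> T" using subgroup.m_inv_closed[OF T_subgroup t(1)] .
  have itN: "inv t \<in> N" using it T(2) by blast
  \<comment> \<open>Split \<open>q\<close> into \<open>u\<close> in \<open>T\<close> and
    \<open>a\<close> in the complement, which \<open>N\<close> normalises. As \<open>u\<close> fixes
    the block of \<open>w\<close> and commutes with \<open>c\<close> on blocks, it fixes the block
    of \<open>\<phi> c w\<close>, which is that of \<open>\<phi> t w\<close>.\<close>
  have QT: "conjug (inv t) q \<in> Q T" if q: "q \<in> Q T" for q
  proof -
    have qN: "q \<in> N" using q Q_subset_N by blast
    obtain u a where ua: "u \<in> T" "a \<in> gen (factors - {T})" "q = u \<otimes> a"
      by (rule N_decompose[OF T_factor qN])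
    have uc: "u \<in> carrier G" "a \<in> carrier G" using Tc[OF ua(1)] complement_carrier[OF ua(2)] .
    have aQ: "a \<in> Q T" using ua(2) gen_subset_Q by blast
    have "q \<otimes> inv a \<in> Q T"
      using q aQ subgroup.m_closed[OF Q_subgroup] subgroup.m_inv_closed[OF Q_subgroup] by blast
    then have "u \<in> Q T" using ua(3) uc by (simp add: m_assoc)
    moreover have uN: "u \<in> N" using ua(1) T(2) by blast
    ultimately have uw: "coord (\<phi> u w) = coord w" using Q_T_iff by blast
    have cl: "\<phi> t w \<in> \<Omega>" "\<phi> c w \<in> \<Omega>" "\<phi> u w \<in> \<Omega>" using act_closed w tc cc uc by blast+
    have "coord (\<phi> u (\<phi> t w)) = coord (\<phi> u (\<phi> c w))"
      using coord_act[OF Tn[OF ua(1)] cl(1,2) t(2)] .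
    also have "\<dots> = coord (\<phi> c (\<phi> u w))" using comm[OF ua(1) w] by simp
    also have "\<dots> = coord (\<phi> c w)" by (rule coord_act[OF c cl(3) w uw])
    also have "\<dots> = coord (\<phi> t w)" using t(2) by simp
    finally have "coord (\<phi> (inv t) (\<phi> u (\<phi> t w))) = coord (\<phi> (inv t) (\<phi> t w))"
      by (rule coord_act[OF Tn[OF it] act_closed[OF uc(1) cl(1)] cl(1)])
    then have "coord (\<phi> (conjug (inv t) u) w) = coord w"
      using tc uc by (simp add: conjug_def act_mult act_inv act_closed w)
    moreover have "conjug (inv t) u \<in> N" using N_normal uN tc by simp
    ultimately have "conjug (inv t) u \<in> Q T" using Q_T_iff by blast
    moreover have "conjug (inv t) a \<in> Q T"
      using gen_N_normal[OF _ itN ua(2)] gen_subset_Q by blast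
    ultimately show ?thesis
      using ua(3) uc tc subgroup.m_closed[OF Q_subgroup] by (simp add: conjug_mult)
  qed
  have "inv t \<in> S"
  proof (rule normalizes_Q[OF itN])
    fix i assume i: "i \<in> factors"
    show "conjug (inv t) ` Q i = Q i"
    proof (cases "i = T")
      case True
      have Qc: "Q T \<subseteq> carrier G" by (rule subgroup.subset[OF Q_subgroup])
      have "conjug (inv t) ` Q T = Q T"
        by (rule conjug_image_eq_if_subset[OF finite_subset[OF Qc finite_carrier] Qc])
          (use tc QT in auto)
      then show ?thesis using True by simp
    next
      case False
      then have "inv t \<in> Q i" using factor_subset_Q[OF T_factor] it by blast
      then show ?thesis by (rule conjug_image_subgroup[OF Q_subgroup])
    qed
  qed
  then have "\<phi> (inv t) w = w" by (simp add: S_iff)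
  then have "\<phi> t w = w" using act_inv(2)[OF tc w] by simp
  then have cw: "coord (\<phi> c w) = coord w" using t(2) by simp
  obtain u where u: "u \<in> T" "coord (\<phi> u w) = coord x" using coord_T_transitive[OF w x] by blast
  have uc: "u \<in> carrier G" by (rule Tc[OF u(1)])
  have "coord (\<phi> c x) = coord (\<phi> c (\<phi> u w))"
    using coord_act[OF c act_closed[OF uc w] x u(2)] by simp
  also have "\<dots> = coord (\<phi> u (\<phi> c w))" by (rule comm[OF u(1) w])
  also have "\<dots> = coord (\<phi> u w)" by (rule coord_act[OF Tn[OF u(1)] act_closed[OF cc w] w cw])
  finally show ?thesis using u(2) by simp
qed

end

section \<open>The almost simple component and the embedding\<close>

context minimal_normal
begin

definition coords :: "'c set" where
  "coords = coord ` \<Omega>"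

text \<open>The action on \<open>T\<close>-blocks, carried over to their representatives;
  \<open>coord\<close> is applied again because the image of a representative need not be
  one.\<close>

definition induced :: "'a \<Rightarrow> 'c \<Rightarrow> 'c" where
  "induced g = (\<lambda>s\<in>coords. coord (\<phi> g s))"

abbreviation component :: "('c \<Rightarrow> 'c) monoid" where
  "component \<equiv> perm_group coords (induced ` normT)"

lemma induced_coord:
  assumes "g \<in> normT" "x \<in> \<Omega>"
  shows "induced g (coord x) = coord (\<phi> g x)"
  using coord_act[OF assms(1) coord(1)[OF assms(2)] assms(2) coord_coord[OF assms(2)]] assms(2)
  by (simp add: induced_def coords_def)

lemma induced_eq_iff:
  assumes "g \<in> normT" "h \<in> normT"
  shows "induced g = induced h \<longleftrightarrow> (\<forall>x\<in>\<Omega>. coord (\<phi> g x) = coord (\<phi> h x))"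
proof
  assume "induced g = induced h"
  then show "\<forall>x\<in>\<Omega>. coord (\<phi> g x) = coord (\<phi> h x)" using induced_coord assms by metis
next
  assume *: "\<forall>x\<in>\<Omega>. coord (\<phi> g x) = coord (\<phi> h x)"
  show "induced g = induced h"
  proof
    fix s
    show "induced g s = induced h s"
      using * coord(1) by (auto simp: induced_def coords_def)
  qed
qed

lemma induced_comp:
  assumes "g \<in> normT" "h \<in> normT"
  shows "compose coords (induced g) (induced h) = induced (g \<otimes> h)"
proof (rule extensionalityI[where A = coords])
  fix s assume s: "s \<in> coords"
  then obtain x where x: "x \<in> \<Omega>" "s = coord x" by (auto simp: coords_def)
  have hx: "\<phi> h x \<in> \<Omega>" using act_closed[OF normT_carrier[OF assms(2)] x(1)] .
  show "compose coords (induced g) (induced h) s = induced (g \<otimes> h) s"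
    using s x assms hx subgroup.m_closed[OF normT_subgroup assms]
    by (simp add: compose_eq induced_coord act_mult normT_carrier)
qed (auto simp: induced_def)

lemma induced_Bij:
  assumes g: "g \<in> normT"
  shows "induced g \<in> Bij coords"
proof -
  have gi: "inv g \<in> normT" using subgroup.m_inv_closed[OF normT_subgroup g] .
  have gc: "g \<in> carrier G" by (rule normT_carrier[OF g])
  have maps: "induced h ` coords \<subseteq> coords" if "h \<in> normT" for h
    using that act_closed[OF normT_carrier[OF that]] by (auto simp: coords_def induced_coord)
  have "bij_betw (induced g) coords coords"
  proof (rule bij_betw_byWitness[where f' = "induced (inv g)"])
    show "\<forall>a\<in>coords. induced (inv g) (induced g a) = a"
      using g gi gc by (auto simp: coords_def induced_coord act_closed act_inv)
    show "\<forall>a\<in>coords. induced g (induced (inv g) a) = a"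
      using g gi gc by (auto simp: coords_def induced_coord act_closed act_inv)
  qed (use maps g gi in auto)
  then show ?thesis by (simp add: Bij_def induced_def)
qed

lemma induced_hom: "group_hom (G\<lparr>carrier := normT\<rparr>) (BijGroup coords) induced"
proof -
  have "group (G\<lparr>carrier := normT\<rparr>)"
    by (rule subgroup.subgroup_is_group[OF normT_subgroup group_axioms])
  moreover have "induced \<in> hom (G\<lparr>carrier := normT\<rparr>) (BijGroup coords)"
    by (auto simp: hom_def BijGroup_def induced_Bij induced_comp)
  ultimately show ?thesis
    by (simp add: group_hom_def group_hom_axioms_def group_BijGroup)
qed

lemma component_subgroup: "subgroup (induced ` normT) (BijGroup coords)"
  using group_hom.img_is_subgroup[OF induced_hom] by simp

lemma component_group: "group component"
  unfolding perm_group_def by (rule subgroup.subgroup_is_group[OF component_subgroup group_BijGroup])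

lemma component_hom: "group_hom (G\<lparr>carrier := normT\<rparr>) component induced"
proof -
  have "induced \<in> hom (G\<lparr>carrier := normT\<rparr>) component"
    using group_hom.homh[OF induced_hom] by (auto simp: hom_def perm_group_def)
  then show ?thesis
    using induced_hom component_group by (simp add: group_hom_def group_hom_axioms_def)
qed

lemma component_carrier: "carrier component = induced ` normT"
  by (simp add: perm_group_def)

lemma component_mult:
  "g \<in> normT \<Longrightarrow> h \<in> normT \<Longrightarrow> induced g \<otimes>\<^bsub>component\<^esub> induced h = induced (g \<otimes> h)"
  using group_hom.hom_mult[OF component_hom, of g h] by simp

lemma component_conjug:
  assumes "g \<in> normT" "h \<in> normT"
  shows "group.conjug component (induced g) (induced h) = induced (conjug g h)"
proof -
  have "inv\<^bsub>component\<^esub> (induced g) = induced (inv g)"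
    using group_hom.hom_inv[OF component_hom, of g] assms(1) m_inv_consistent[OF normT_subgroup assms(1)]
    by simp
  then show ?thesis
    using assms subgroup.m_inv_closed[OF normT_subgroup assms(1)] subgroup.m_closed[OF normT_subgroup]
    by (simp add: group.conjug_def[OF component_group] conjug_def component_mult)
qed

lemma component_one: "\<one>\<^bsub>component\<^esub> = induced \<one>"
  using group_hom.hom_one[OF component_hom] by simp

text \<open>The criterion is applied to the image of \<open>T\<close>: minimality is pulled back to
  \<open>T_simple\<close>, and \<open>coord_centralizer_trivial\<close> gives the trivial
  centraliser.\<close>

lemma component_almost_simple: "almost_simple component"
proof (rule almost_simpleI[OF component_group])
  interpret M: group component by (rule component_group)
  interpret l: group_hom "G\<lparr>carrier := normT\<rparr>" component induced by (rule component_hom)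
  note Tn = subsetD[OF T_subset_normT]
  show "finite (induced ` T)"
    using finite_subset[OF T_subset_carrier finite_carrier] by simp
  have conjT: "conjug g t \<in> T" if "g \<in> normT" "t \<in> T" for g t
    using that by (auto simp: normT_def)
  show "M.conjug g t \<in> induced ` T"
    if g: "g \<in> carrier component" and t: "t \<in> induced ` T" for g t
  proof -
    obtain a b where "a \<in> normT" "g = induced a" "b \<in> T" "t = induced b"
      using g t by (auto simp: component_carrier)
    then show ?thesis using component_conjug Tn conjT by simp
  qed
  show "g = \<one>\<^bsub>component\<^esub>"
    if g: "g \<in> carrier component" and cent: "\<And>t. t \<in> induced ` T \<Longrightarrow> M.conjug g t = t" for g
  proof -
    obtain c where c: "c \<in> normT" "g = induced c" using g by (auto simp: component_carrier)
    have comm: "coord (\<phi> c (\<phi> t x)) = coord (\<phi> t (\<phi> c x))" if t: "t \<in> T" and x: "x \<in> \<Omega>" for t x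
    proof -
      have tn: "t \<in> normT" by (rule Tn[OF t])
      have tM: "induced t \<in> carrier component" using tn by (simp add: component_carrier)
      have "g \<otimes>\<^bsub>component\<^esub> induced t = induced t \<otimes>\<^bsub>component\<^esub> g"
        using cent[of "induced t"] t M.conjug_fixed_iff[OF g tM] by simp
      then have "induced (c \<otimes> t) = induced (t \<otimes> c)" using c tn by (simp add: component_mult)
      then have "coord (\<phi> (c \<otimes> t) x) = coord (\<phi> (t \<otimes> c) x)"
        using induced_eq_iff x c(1) tn subgroup.m_closed[OF normT_subgroup] by blast
      then show ?thesis using c(1) tn x normT_carrier by (simp add: act_mult)
    qed
    have "induced c = induced \<one>"
      unfolding induced_eq_iff[OF c(1) subgroup.one_closed[OF normT_subgroup]]
      using coord_centralizer_trivial[OF c(1) comm] act_one by simp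
    then show ?thesis using c(2) component_one by simp
  qed
  show "M.minimal_invariant (induced ` T) (induced ` T)"
    unfolding M.minimal_invariant_def
  proof (intro conjI ballI allI impI)
    have "subgroup T (G\<lparr>carrier := normT\<rparr>)"
      by (rule subgroup_incl[OF T_subgroup normT_subgroup T_subset_normT])
    then show Ts: "subgroup (induced ` T) component" by (rule l.subgroup_img_is_subgroup)
    show "M.conjug g ` induced ` T \<subseteq> induced ` T" if "g \<in> induced ` T" for g
      using M.conjug_image_subgroup[OF Ts that] by simp
    show "induced ` T \<noteq> {\<one>\<^bsub>component\<^esub>}"
    proof
      assume *: "induced ` T = {\<one>\<^bsub>component\<^esub>}"
      have "t = \<one>" if t: "t \<in> T" for t
      proof (rule T_coord_faithful[OF t])
        have "induced t = induced \<one>" using imageI[OF t, of induced] * component_one by simp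
        then show "coord (\<phi> t x) = coord x" if "x \<in> \<Omega>" for x
          using induced_eq_iff[OF Tn[OF t] subgroup.one_closed[OF normT_subgroup]] that act_one by simp
      qed
      then show False
        using minimal_invariant_nontrivial[OF T(1)] subgroup.one_closed[OF T_subgroup] by blast
    qed
    fix B assume B: "subgroup B component" "B \<subseteq> induced ` T"
      "\<forall>g\<in>induced ` T. M.conjug g ` B \<subseteq> B"
    \<comment> \<open>The preimage of \<open>B\<close> in \<open>T\<close>, to which simplicity of
      \<open>T\<close> applies.\<close>
    define C where "C = {t \<in> T. induced t \<in> B}"
    have "C = {\<one>} \<or> C = T"
    proof (rule minimal_invariantD[OF T_simple])
      show "subgroup C G"
      proof (rule subgroupI)
        show "C \<subseteq> carrier G" using T_subset_carrier by (auto simp: C_def)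
        have "\<one> \<in> C"
          using subgroup.one_closed[OF B(1)] subgroup.one_closed[OF T_subgroup]
          by (simp add: C_def component_one)
        then show "C \<noteq> {}" by blast
        show "inv a \<in> C" if a: "a \<in> C" for a
        proof -
          have an: "a \<in> normT" using a Tn by (simp add: C_def)
          have "induced (inv a) = inv\<^bsub>component\<^esub> (induced a)"
            using l.hom_inv[of a] m_inv_consistent[OF normT_subgroup an] an by simp
          then show ?thesis
            using a subgroup.m_inv_closed[OF B(1)] subgroup.m_inv_closed[OF T_subgroup]
            by (simp add: C_def)
        qed
        show "a \<otimes> b \<in> C" if "a \<in> C" "b \<in> C" for a b
          using that Tn subgroup.m_closed[OF T_subgroup] subgroup.m_closed[OF B(1), of "induced a" "induced b"]
          by (simp add: C_def component_mult)
      qed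
      show "conjug g b \<in> C" if g: "g \<in> T" and b: "b \<in> C" for g b
      proof -
        have "M.conjug (induced g) (induced b) \<in> B" using B(3) g b by (auto simp: C_def)
        then show ?thesis
          using component_conjug[of g b] g b Tn conjug_mem_subgroup[OF T_subgroup] by (simp add: C_def)
      qed
    qed (auto simp: C_def)
    moreover have "B = induced ` C" using B(2) by (auto simp: C_def)
    ultimately show "B = {\<one>\<^bsub>component\<^esub>} \<or> B = induced ` T"
      using component_one by auto
  qed
qed

text \<open>Fixed elements \<open>r i\<close> identify the blocks of the \<open>i\<close>-th factor
  with those of \<open>T\<close>. An element of \<open>G\<close> permutes the factors, and its
  deviation from the chosen identifications normalises \<open>T\<close>.\<close>

lemma wreath_embedding:
  "perm_embeds G \<Omega> \<phi> (wreath_product component (card factors))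
     (cartesian_power coords (card factors)) (product_action coords (card factors))"
proof -
  let ?k = "card factors"
  let ?I = "{1..?k}"
  obtain e where e: "bij_betw e ?I factors"
    using ex_bij_betw_nat_finite_1[OF finite_factors] by blast
  have e_factor: "e i \<in> factors" if "i \<in> ?I" for i using bij_betwE[OF e] that by blast
  have e_inj: "i = j" if "i \<in> ?I" "j \<in> ?I" "e i = e j" for i j
    using inj_onD[OF bij_betw_imp_inj_on[OF e]] that by blast
  have "\<exists>g. g \<in> carrier G \<and> conjug g ` T = e i" if "i \<in> ?I" for i
    using e_factor[OF that] by (auto simp: factors_def)
  then obtain r where r: "\<And>i. i \<in> ?I \<Longrightarrow> r i \<in> carrier G" "\<And>i. i \<in> ?I \<Longrightarrow> conjug (r i) ` T = e i"
    by metis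
  have r_inv: "conjug (inv (r i)) ` e i = T" if "i \<in> ?I" for i
    using conjug_image_inv_cancel(1)[OF r(1)[OF that] T_subset_carrier] r(2)[OF that] by simp
  define f where "f x = (\<lambda>i\<in>?I. coord (\<phi> (inv (r i)) x))" for x
  have f_eq_iff: "coord (\<phi> (inv (r i)) x) = coord (\<phi> (inv (r i)) y) \<longleftrightarrow> same_block (e i) x y"
    if i: "i \<in> ?I" and x: "x \<in> \<Omega>" and y: "y \<in> \<Omega>" for i x y
  proof -
    have c: "r i \<in> carrier G" "inv (r i) \<in> carrier G" using r(1)[OF i] by simp_all
    have cl: "\<phi> (inv (r i)) x \<in> \<Omega>" "\<phi> (inv (r i)) y \<in> \<Omega>" using act_closed[OF c(2)] x y by blast+
    have "same_block T (\<phi> (inv (r i)) x) (\<phi> (inv (r i)) y) \<longleftrightarrow> same_block (e i) x y"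
      using same_block_act[OF c(2) e_factor[OF i] x, of y] r_inv[OF i]
        same_block_act[OF c(1) T_factor cl(1), of "\<phi> (inv (r i)) y"] r(2)[OF i]
        act_inv(2)[OF c(1) x] act_inv(2)[OF c(1) y] by auto
    then show ?thesis using coord_eq_iff[OF cl] by simp
  qed
  have f_bij: "bij_betw f \<Omega> (cartesian_power coords ?k)"
  proof (rule bij_betw_imageI)
    show "inj_on f \<Omega>"
    proof (rule inj_onI)
      fix x y assume x: "x \<in> \<Omega>" and y: "y \<in> \<Omega>" and fxy: "f x = f y"
      show "x = y"
      proof (rule same_block_eqI[OF x y])
        fix j assume "j \<in> factors"
        then have "j \<in> e ` ?I" using bij_betw_imp_surj_on[OF e] by simp
        then obtain i where i: "i \<in> ?I" "e i = j" by blast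
        show "same_block j x y"
          using fun_cong[OF fxy, of i] f_eq_iff[OF i(1) x y] i by (simp add: f_def)
      qed
    qed
    show "f ` \<Omega> = cartesian_power coords ?k"
    proof
      have "coord (\<phi> (inv (r i)) x) \<in> coords" if "i \<in> ?I" "x \<in> \<Omega>" for i x
        using that r(1) act_closed by (simp add: coords_def)
      then show "f ` \<Omega> \<subseteq> cartesian_power coords ?k" by (auto simp: f_def)
      show "cartesian_power coords ?k \<subseteq> f ` \<Omega>"
      proof
        fix s assume s: "s \<in> cartesian_power coords ?k"
        have "\<exists>x\<in>\<Omega>. s i = coord x" if "i \<in> ?I" for i
          using PiE_mem[OF s that] by (auto simp: coords_def)
        then obtain y where y: "\<And>i. i \<in> ?I \<Longrightarrow> y i \<in> \<Omega>" "\<And>i. i \<in> ?I \<Longrightarrow> s i = coord (y i)"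
          by metis
        \<comment> \<open>\<open>r i\<close> moves the prescribed \<open>T\<close>-block to a block
          of the factor \<open>e i\<close>; indexing by factors suits
          \<open>same_block_solve\<close>.\<close>
        define z where "z j = (let i = inv_into ?I e j in \<phi> (r i) (y i))" for j
        have inv_e: "inv_into ?I e j \<in> ?I" if "j \<in> factors" for j
          using that e by (metis bij_betw_imp_surj_on inv_into_into)
        have "z j \<in> \<Omega>" if "j \<in> factors" for j
          using y(1) r(1) inv_e[OF that] act_closed by (simp add: z_def Let_def)
        then obtain x where x: "x \<in> \<Omega>" "\<And>j. j \<in> factors \<Longrightarrow> same_block j (z j) x"
          using same_block_solve[OF finite_factors subset_refl] by blast
        have "f x = s"
        proof (rule extensionalityI[where A = ?I])
          fix i assume i: "i \<in> ?I"
          have ze: "z (e i) = \<phi> (r i) (y i)"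
            using bij_betw_inv_into_left[OF e i] by (simp add: z_def)
          then have zO: "z (e i) \<in> \<Omega>" using act_closed r(1) y(1) i by simp
          have "coord (\<phi> (inv (r i)) (z (e i))) = coord (\<phi> (inv (r i)) x)"
            using f_eq_iff[OF i zO x(1)] x(2)[OF e_factor[OF i]] by blast
          then show "f x i = s i"
            using ze act_inv(1)[OF r(1)[OF i] y(1)[OF i]] i y(2) by (simp add: f_def)
        qed (use s in \<open>auto simp: f_def PiE_iff\<close>)
        then show "s \<in> f ` \<Omega>" using x(1) by blast
      qed
    qed
  qed
  \<comment> \<open>The permutation of the factors by conjugation, read on indices; outside the
    index range it must be the identity to satisfy \<open>permutes\<close>.\<close>
  define \<sigma> where "\<sigma> g i = (if i \<in> ?I then inv_into ?I e (conjug g ` e i) else i)" for g i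
  have \<sigma>_mem: "\<sigma> g i \<in> ?I" and e_\<sigma>: "e (\<sigma> g i) = conjug g ` e i"
    if "g \<in> carrier G" "i \<in> ?I" for g i
  proof -
    have "conjug g ` e i \<in> e ` ?I"
      using factor_conjug[OF e_factor[OF that(2)] that(1)] e by (simp add: bij_betw_def)
    then show "\<sigma> g i \<in> ?I" "e (\<sigma> g i) = conjug g ` e i"
      using that(2) by (simp_all only: \<sigma>_def if_True inv_into_into f_inv_into_f)
  qed
  have e_carrier: "e i \<subseteq> carrier G" if "i \<in> ?I" for i
    by (rule subgroup.subset[OF factor_subgroup[OF e_factor[OF that]]])
  have \<sigma>_permutes: "\<sigma> g permutes ?I" if g: "g \<in> carrier G" for g
  proof (rule bij_imp_permutes)
    have "inj_on (\<sigma> g) ?I"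
    proof (rule inj_onI)
      fix i j assume i: "i \<in> ?I" and j: "j \<in> ?I" and "\<sigma> g i = \<sigma> g j"
      then have "conjug g ` e i = conjug g ` e j" using e_\<sigma>[OF g i] e_\<sigma>[OF g j] by simp
      then have "e i = e j"
        using conjug_image_inv_cancel(1)[OF g e_carrier[OF i]]
          conjug_image_inv_cancel(1)[OF g e_carrier[OF j]] by metis
      then show "i = j" by (rule e_inj[OF i j])
    qed
    then show "bij_betw (\<sigma> g) ?I ?I"
      using \<sigma>_mem[OF g] endo_inj_surj[of ?I "\<sigma> g"] by (simp add: bij_betw_def image_subset_iff)
    show "\<sigma> g i = i" if "i \<notin> ?I" for i using that by (simp only: \<sigma>_def if_False)
  qed
  have \<sigma>_mult: "\<sigma> (g \<otimes> h) = \<sigma> g \<circ> \<sigma> h" if g: "g \<in> carrier G" and h: "h \<in> carrier G" for g h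
  proof
    fix i
    show "\<sigma> (g \<otimes> h) i = (\<sigma> g \<circ> \<sigma> h) i"
    proof (cases "i \<in> ?I")
      case True
      have "e (\<sigma> (g \<otimes> h) i) = e (\<sigma> g (\<sigma> h i))"
        using e_\<sigma>[OF g \<sigma>_mem[OF h True]] e_\<sigma>[OF h True] e_\<sigma>[OF m_closed[OF g h] True]
          conjug_image_mult_left[OF g h e_carrier[OF True]] by simp
      then show ?thesis
        using e_inj[OF \<sigma>_mem[OF m_closed[OF g h] True] \<sigma>_mem[OF g \<sigma>_mem[OF h True]]] by simp
    next
      case False
      then show ?thesis by (simp only: \<sigma>_def if_False o_apply)
    qed
  qed
  define \<iota> where "\<iota> g = inv_into UNIV (\<sigma> g)" for g
  have \<iota>_mem: "\<iota> g i \<in> ?I" if "g \<in> carrier G" "i \<in> ?I" for g i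
    unfolding \<iota>_def by (rule permutes_inv_into_mem[OF \<sigma>_permutes[OF that(1)] that(2)])
  have \<iota>_mult: "\<iota> (g \<otimes> h) i = \<iota> h (\<iota> g i)" if "g \<in> carrier G" "h \<in> carrier G" for g h i
    unfolding \<iota>_def \<sigma>_mult[OF that]
    by (rule permutes_inv_into_comp[OF \<sigma>_permutes[OF that(1)] \<sigma>_permutes[OF that(2)]])
  \<comment> \<open>On conjugates this runs from \<open>T\<close> to the factor at
    \<open>\<iota> g i\<close>, then by \<open>g\<close> to the factor at \<open>i\<close>, and back
    to \<open>T\<close>, so it lies in \<open>normT\<close>.\<close>
  define b where "b g i = inv (r i) \<otimes> g \<otimes> r (\<iota> g i)" for g i
  have b_normT: "b g i \<in> normT" if g: "g \<in> carrier G" and i: "i \<in> ?I" for g i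
  proof -
    note j = \<iota>_mem[OF g i]
    have "\<sigma> g (\<iota> g i) = i"
      unfolding \<iota>_def by (rule permutes_inverses(1)[OF \<sigma>_permutes[OF g]])
    then have ge: "conjug g ` e (\<iota> g i) = e i" using e_\<sigma>[OF g j] by simp
    have c: "r i \<in> carrier G" "r (\<iota> g i) \<in> carrier G" using r(1) i j by blast+
    have "conjug (b g i) ` T = conjug (inv (r i)) ` conjug g ` conjug (r (\<iota> g i)) ` T"
      using c g T_subset_carrier by (simp add: b_def conjug_image_mult_left conjug_image_closed)
    then show ?thesis using r(2)[OF j] ge r_inv[OF i] c g by (simp add: normT_def b_def)
  qed
  \<comment> \<open>The cocycle identity: the inner representatives cancel, and the shift by
    \<open>\<iota> g\<close> is the twist in the multiplication of the wreath product.\<close>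
  have b_mult: "b (g \<otimes> h) i = b g i \<otimes> b h (\<iota> g i)"
    if g: "g \<in> carrier G" and h: "h \<in> carrier G" and i: "i \<in> ?I" for g h i
    using r(1)[OF i] r(1)[OF \<iota>_mem[OF g i]] r(1)[OF \<iota>_mem[OF h \<iota>_mem[OF g i]]] g h
    by (simp add: b_def \<iota>_mult m_assoc)
  define h where "h g = ((\<lambda>i\<in>?I. induced (b g i)), \<sigma> g)" for g
  have equivariant: "f (\<phi> g x) = product_action coords ?k (h g) (f x)"
    if g: "g \<in> carrier G" and x: "x \<in> \<Omega>" for g x
  proof (rule extensionalityI[where A = ?I])
    have fx: "f x \<in> cartesian_power coords ?k" using bij_betwE[OF f_bij] x by blast
    show "f (\<phi> g x) \<in> extensional ?I" by (simp add: f_def)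
    show "product_action coords ?k (h g) (f x) \<in> extensional ?I"
      using fx by (simp add: product_action_def h_def)
    fix i assume i: "i \<in> ?I"
    note j = \<iota>_mem[OF g i]
    have c: "r i \<in> carrier G" "r (\<iota> g i) \<in> carrier G" using r(1) i j by blast+
    let ?x = "\<phi> (inv (r (\<iota> g i))) x"
    have "product_action coords ?k (h g) (f x) i = induced (b g i) (coord ?x)"
      using fx i j by (simp add: product_action_def h_def f_def flip: \<iota>_def)
    also have "\<dots> = coord (\<phi> (b g i) ?x)"
      by (rule induced_coord[OF b_normT[OF g i]]) (use c x act_closed in simp)
    also have "\<phi> (b g i) ?x = \<phi> (inv (r i)) (\<phi> g x)"
      using c g x by (simp add: b_def act_mult act_closed act_inv)
    also have "coord (\<phi> (inv (r i)) (\<phi> g x)) = f (\<phi> g x) i" using i by (simp add: f_def)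
    finally show "f (\<phi> g x) i = product_action coords ?k (h g) (f x) i" ..
  qed
  have "h \<in> hom G (wreath_product component ?k)"
  proof (rule homI)
    show "h g \<in> carrier (wreath_product component ?k)" if g: "g \<in> carrier G" for g
      using b_normT[OF g] \<sigma>_permutes[OF g]
      by (simp add: h_def wreath_product_def product_group_def sym_group_def component_carrier)
    show "h (g \<otimes> g') = h g \<otimes>\<^bsub>wreath_product component ?k\<^esub> h g'"
      if g: "g \<in> carrier G" and g': "g' \<in> carrier G" for g g'
    proof -
      have "induced (b (g \<otimes> g') i) =
          induced (b g i) \<otimes>\<^bsub>component\<^esub> (\<lambda>i\<in>?I. induced (b g' i)) (\<iota> g i)" if i: "i \<in> ?I" for i
        using b_mult[OF g g' i] component_mult[OF b_normT[OF g i] b_normT[OF g' \<iota>_mem[OF g i]]] \<iota>_mem[OF g i]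
        by simp
      then show ?thesis
        by (simp add: h_def wreath_product_def product_group_def \<sigma>_mult[OF g g'] flip: \<iota>_def
            cong: restrict_cong)
    qed
  qed
  moreover have "inj_on h (carrier G)"
  proof (rule inj_onI)
    fix g g' assume g: "g \<in> carrier G" and g': "g' \<in> carrier G" and hg: "h g = h g'"
    \<comment> \<open>Equal images act equally on coordinates, so injectivity of \<open>f\<close>
      and faithfulness of the action give equality in \<open>G\<close>.\<close>
    have "inv g' \<otimes> g = \<one>"
    proof (rule act_eq_one)
      fix x assume x: "x \<in> \<Omega>"
      have "f (\<phi> g x) = f (\<phi> g' x)" using equivariant g g' x hg by simp
      then have "\<phi> g x = \<phi> g' x"
        using inj_onD[OF bij_betw_imp_inj_on[OF f_bij]] act_closed g g' x by blast
      then show "\<phi> (inv g' \<otimes> g) x = x" using g g' x by (simp add: act_mult act_inv)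
    qed (use g g' in simp)
    then show "g = g'" using g g' by (metis inv_closed inv_equality inv_inv)
  qed
  ultimately show ?thesis
    unfolding perm_embeds_def using f_bij equivariant by blast
qed

end

section \<open>Regular subgroups\<close>

text \<open>Nontrivial elements of \<open>R\<close> have no fixed points, so a fixer
  \<open>K\<close> meets \<open>R\<close> trivially and \<open>card K * card R\<close> is at most
  the group order. That order is \<open>card E\<close> times the stabiliser order, and
  \<open>card R = card E\<close>.\<close>

lemma (in faithful_action) weak_EKR_if_regular:
  assumes fin: "finite (carrier G)" and trans: "transitive_action G E \<phi>"
    and R: "subgroup R G" "\<And>x y. x \<in> E \<Longrightarrow> y \<in> E \<Longrightarrow> \<exists>r\<in>R. \<phi> r x = y"
      "\<And>r x. r \<in> R \<Longrightarrow> x \<in> E \<Longrightarrow> \<phi> r x = x \<Longrightarrow> r = \<one>"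
  shows "weak_EKR G E \<phi>"
  unfolding weak_EKR_def
proof (intro allI impI ballI)
  interpret group G using group_hom by (simp add: group_hom_def)
  fix K x assume K: "fixer G E \<phi> K" and x: "x \<in> E"
  have Ks: "subgroup K G" and Kf: "\<And>g. g \<in> K \<Longrightarrow> \<exists>y\<in>E. \<phi> g y = y"
    using K by (auto simp: fixer_def)
  note Kc = subgroup.mem_carrier[OF Ks] and Rc = subgroup.mem_carrier[OF R(1)]
  have "inj_on (\<lambda>(k, r). k \<otimes> r) (K \<times> R)"
  proof (rule inj_onI, clarify)
    fix k r k' r' assume kr: "k \<in> K" "r \<in> R" "k' \<in> K" "r' \<in> R" "k \<otimes> r = k' \<otimes> r'"
    note c = Kc[OF kr(1)] Rc[OF kr(2)] Kc[OF kr(3)] Rc[OF kr(4)]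
    have "inv k' \<otimes> k = inv k' \<otimes> (k \<otimes> r) \<otimes> inv r" using c by (simp add: m_assoc)
    also have "\<dots> = r' \<otimes> inv r" using c kr(5) by (simp flip: m_assoc)
    finally have eq: "inv k' \<otimes> k = r' \<otimes> inv r" .
    \<comment> \<open>The same element lies in \<open>R\<close>, and membership in the fixer gives
      it a fixed point, so it is trivial.\<close>
    have "inv k' \<otimes> k \<in> K"
      using kr subgroup.m_closed[OF Ks] subgroup.m_inv_closed[OF Ks] by blast
    then obtain y where "y \<in> E" "\<phi> (inv k' \<otimes> k) y = y" using Kf by blast
    moreover have "r' \<otimes> inv r \<in> R"
      using kr subgroup.m_closed[OF R(1)] subgroup.m_inv_closed[OF R(1)] by blast
    ultimately have "r' \<otimes> inv r = \<one>" using R(3) eq by simp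
    then have "r = r'" using c by (metis inv_closed inv_equality inv_inv)
    then show "k = k' \<and> r = r'" using c kr(5) by simp
  qed
  then have "card (K \<times> R) \<le> card (carrier G)"
    by (rule card_inj_on_le) (use Kc Rc fin in auto)
  then have 1: "card K * card R \<le> order G" by (simp add: card_cartesian_product order_def)
  have orb: "orbit G \<phi> x = E"
    using transitive_action.unique_orbit[OF trans x] element_image x by (auto simp: orbit_def)
  have 2: "order G = card E * card (stabilizer G \<phi> x)"
    using orbit_stabilizer_theorem[OF x] orb by simp
  have "bij_betw (\<lambda>r. \<phi> r x) R E"
  proof (rule bij_betw_imageI)
    show "inj_on (\<lambda>r. \<phi> r x) R"
    proof (rule inj_onI)
      fix r s assume rs: "r \<in> R" "s \<in> R" "\<phi> r x = \<phi> s x"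
      have "\<phi> (inv s \<otimes> r) x = x"
        using rs Rc x orbit_sym_aux[OF Rc[OF rs(2)] x refl] by (simp add: composition_rule)
      moreover have "inv s \<otimes> r \<in> R"
        using rs subgroup.m_closed[OF R(1)] subgroup.m_inv_closed[OF R(1)] by blast
      ultimately have "inv s \<otimes> r = \<one>" using R(3) x by blast
      then show "r = s" using rs Rc by (metis inv_closed inv_equality inv_inv)
    qed
    show "(\<lambda>r. \<phi> r x) ` R = E" using R(2)[OF x] element_image Rc x by blast
  qed
  then have 3: "card R = card E" by (rule bij_betw_same_card)
  have "card R > 0"
    using subgroup.one_closed[OF R(1)] finite_subset[OF subgroup.subset[OF R(1)] fin]
    by (auto simp: card_gt_0_iff)
  then show "card K \<le> card (stabilizer G \<phi> x)" using 1 2 3 by (simp add: mult.commute)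
qed

theorem theorem2p10:
  fixes \<Omega> :: "'a set" and G :: "('a \<Rightarrow> 'a) set"
  assumes "subgroup G (BijGroup \<Omega>)"
    and "finite G"
    and "primitive_action (perm_group \<Omega> G) \<Omega> id"
    and "\<not> weak_EKR (perm_group \<Omega> G) \<Omega> id"
  shows "\<exists>(k::nat) (S :: 'a set) L.
           k \<ge> 1 \<and> subgroup L (BijGroup S) \<and> almost_simple (perm_group S L) \<and>
           perm_embeds (perm_group \<Omega> G) \<Omega> id
             (wreath_product (perm_group S L) k) (cartesian_power S k) (product_action S k)"
proof -
  let ?G = "perm_group \<Omega> G"
  have carrier: "carrier ?G = G" by (simp add: perm_group_def)
  interpret faithful_action ?G \<Omega> id by (rule perm_group_action[OF assms(1)])
  have trans: "transitive_action ?G \<Omega> id" using assms(3) by (simp add: primitive_action_def)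
  interpret primitive_without_regular ?G \<Omega> id
  proof
    show "finite (carrier ?G)" using assms(2) carrier by simp
    show False if R: "subgroup R ?G" "\<forall>x\<in>\<Omega>. \<forall>y\<in>\<Omega>. \<exists>r\<in>R. id r x = y"
      "\<forall>r\<in>R. \<forall>x\<in>\<Omega>. id r x = x \<longrightarrow> r = \<one>\<^bsub>?G\<^esub>" for R
    proof -
      have "weak_EKR ?G \<Omega> id"
        by (rule weak_EKR_if_regular[OF _ trans R(1)]) (use assms(2) carrier R(2,3) in auto)
      then show False using assms(4) by contradiction
    qed
  qed (rule assms(3))
  obtain w where w: "w \<in> \<Omega>" using assms(3) by (auto simp: primitive_action_def)
  \<comment> \<open>A maximal subgroup is proper, so the group is nontrivial and has a minimal
    normal subgroup.\<close>
  have "carrier ?G \<noteq> {\<one>\<^bsub>?G\<^esub>}"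
    using assms(3) w subgroup.one_closed[OF stab_subgroup[OF w]] subgroup.subset[OF stab_subgroup[OF w]]
    by (auto simp: primitive_action_def maximal_subgroup_def)
  then obtain N where N: "N \<subseteq> carrier ?G" "minimal_invariant (carrier ?G) N"
    using minimal_invariant_exists[OF subgroup_self finite_carrier, of "carrier ?G"] by auto
  note Ns = minimal_invariant_subgroup[OF N(2)]
  obtain T where T: "T \<subseteq> N" "minimal_invariant N T"
    using minimal_invariant_exists[OF Ns finite_subset[OF N(1) finite_carrier]
        minimal_invariant_nontrivial[OF N(2)], of N] conjug_image_subgroup[OF Ns] by auto
  interpret minimal_normal ?G \<Omega> id N T w
    by unfold_locales (fact N(2) T w)+
  have "card factors \<ge> 1"
    using T_factor finite_factors by (auto simp: Suc_le_eq card_gt_0_iff)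
  then show ?thesis
    using component_subgroup component_almost_simple wreath_embedding by blast
qed

end
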